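(* Let $\varphi$ be a nontrivial endomorphism of a hyperbolic group $G$ (nontrivial meaning $G\varphi \neq 1$) and let $d \in V^A(p,\gamma,T)$ be a visual metric on $G$, where $A$ is a finite generating set of $G$, $p \in G$, $\gamma > 0$ and $T \geq 1$. Then the following conditions are equivalent: (i) $\varphi$ satisfies a Hölder condition with respect to $d$; (ii) $\varphi$ admits an extension to $\widehat{G}$ satisfying a Hölder condition with respect to $\widehat{d}$; (iii) there exist constants $P > 0$ and $Q \in \mathbb{R}$ such that $P(g\varphi|h\varphi)_p^A + Q \geq (g|h)_p^A$ for all $g,h \in G$; (iv) $\varphi$ is a quasi-isometric embedding of $(G,d_A)$ into itself; (v) $\varphi$ is virtually injective and $G\varphi$ is a quasiconvex subgroup of $G$.
   Context: Maps are written on the right. All generating sets are finite. For $G = \langle A\rangle$, $\widetilde{A} = A \cup A^{-1}$, and $d_A(g,h)$ is the length of a shortest path from $g$ to $h$ in the Cayley graph $\Gamma_A(G)$ (vertex set $G$, edges $g \to ga$ for $a \in \widetilde{A}$). $\overline{\Gamma}_A(G)$ is its geometric realization (edges of length 1), a geodesic metric space whose metric is also denoted $d_A$. $G$ is hyperbolic if $\overline{\Gamma}_A(G)$ is $\delta$-hyperbolic for some $\delta \ge 0$ (every side of every geodesic triangle lies in the closed $\delta$-neighbourhood of the union of the other two sides); this does not depend on $A$. Gromov product: $(g|h)_p^A = \frac12(d_A(p,g)+d_A(p,h)-d_A(g,h))$ for $g,h,p\in G$. Let $\rho^A_{p,\gamma}(g,h) = e^{-\gamma (g|h)_p^A}$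 if $g \ne h$ and $0$ otherwise. For $p \in G$, $\gamma>0$, $T\ge 1$, $V^A(p,\gamma,T)$ is the set of all metrics $d$ on $G$ with $\frac1T\rho^A_{p,\gamma}(g,h) \le d(g,h) \le T\rho^A_{p,\gamma}(g,h)$ for all distinct $g,h\in G$; the metrics in such sets are called visual metrics. $(\widehat{G},\widehat{d})$ denotes the metric completion of $(G,d)$ (so $\widehat{G} = G \cup \partial G$, where $\partial G$ is the Gromov boundary). A map $\varphi:(X,d)\to(X',d')$ satisfies a Hölder condition of exponent $r>0$ if there is $K>0$ with $d'(x\varphi,y\varphi)\le K\,d(x,y)^r$ for all $x,y\in X$; it satisfies a Hölder condition if this holds for some $r>0$. It is a quasi-isometric embedding if there are $\lambda\ge1$, $K\ge0$ with $\frac1\lambda d(x,y)-K\le d'(x\varphi,y\varphi)\le\lambda d(x,y)+K$ for all $x,y \in X$. An endomorphism is virtually injective if its kernel is finite. A subgroup $H\le G$ is quasiconvex if there is $q\ge0$ such that $d_A(x,H)\le q$ for every point $x$ on every geodesic of $\overline{\Gamma}_A(G)$ with endpoints in $H$ (independent of the finite generating set $A$). *)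

theory Defs
  imports "HOL-Analysis.Analysis" "HOL-Algebra.Generated_Groups"
begin

section \<open>Metric notions\<close>

definition geodesic_segment ::
    "'x set \<Rightarrow> ('x \<Rightarrow> 'x \<Rightarrow> real) \<Rightarrow> 'x \<Rightarrow> 'x \<Rightarrow> 'x set \<Rightarrow> bool" where
  "geodesic_segment X d x y S \<longleftrightarrow>
     (\<exists>c l. 0 \<le> l \<and> c \<in> {0..l} \<rightarrow> X \<and> c 0 = x \<and> c l = y \<and>
        (\<forall>s\<in>{0..l}. \<forall>t\<in>{0..l}. d (c s) (c t) = \<bar>s - t\<bar>) \<and> S = c ` {0..l})"

definition dist_to_set :: "('x \<Rightarrow> 'x \<Rightarrow> real) \<Rightarrow> 'x \<Rightarrow> 'x set \<Rightarrow> real" where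
  "dist_to_set d x S = (INF s\<in>S. d x s)"

definition closed_nbhd :: "'x set \<Rightarrow> ('x \<Rightarrow> 'x \<Rightarrow> real) \<Rightarrow> real \<Rightarrow> 'x set \<Rightarrow> 'x set" where
  "closed_nbhd X d \<delta> S = {x \<in> X. dist_to_set d x S \<le> \<delta>}"

definition delta_hyperbolic :: "'x set \<Rightarrow> ('x \<Rightarrow> 'x \<Rightarrow> real) \<Rightarrow> real \<Rightarrow> bool" where
  "delta_hyperbolic X d \<delta> \<longleftrightarrow>
     (\<forall>x y z S1 S2 S3.
        geodesic_segment X d x y S1 \<and> geodesic_segment X d y z S2 \<and> geodesic_segment X d z x S3 \<longrightarrow>
          S1 \<subseteq> closed_nbhd X d \<delta> (S2 \<union> S3) \<and>
          S2 \<subseteq> closed_nbhd X d \<delta> (S1 \<union> S3) \<and>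
          S3 \<subseteq> closed_nbhd X d \<delta> (S1 \<union> S2))"

definition holder_condition ::
    "'x set \<Rightarrow> ('x \<Rightarrow> 'x \<Rightarrow> real) \<Rightarrow> ('y \<Rightarrow> 'y \<Rightarrow> real) \<Rightarrow> ('x \<Rightarrow> 'y) \<Rightarrow> bool" where
  "holder_condition X d d' f \<longleftrightarrow>
     (\<exists>r>0. \<exists>K>0. \<forall>x\<in>X. \<forall>y\<in>X. d' (f x) (f y) \<le> K * d x y powr r)"

definition qi_embedding ::
    "'x set \<Rightarrow> ('x \<Rightarrow> 'x \<Rightarrow> real) \<Rightarrow> ('y \<Rightarrow> 'y \<Rightarrow> real) \<Rightarrow> ('x \<Rightarrow> 'y) \<Rightarrow> bool" where
  "qi_embedding X d d' f \<longleftrightarrow>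
     (\<exists>L\<ge>1. \<exists>K\<ge>0. \<forall>x\<in>X. \<forall>y\<in>X.
        1 / L * d x y - K \<le> d' (f x) (f y) \<and> d' (f x) (f y) \<le> L * d x y + K)"

text \<open>A complete metric space together with an isometric embedding of \<open>(M, d)\<close> onto a dense
  subset, in the form of \<open>Metric_space.metric_completion\<close>.\<close>

definition is_metric_completion ::
    "'x set \<Rightarrow> ('x \<Rightarrow> 'x \<Rightarrow> real) \<Rightarrow> 'y metric \<Rightarrow> ('x \<Rightarrow> 'y) \<Rightarrow> bool" where
  "is_metric_completion M d m \<iota> \<longleftrightarrow>
     mcomplete_of m \<and> \<iota> \<in> M \<rightarrow> mspace m \<and>
     mtopology_of m closure_of (\<iota> ` M) = mspace m \<and>
     (\<forall>x\<in>M. \<forall>y\<in>M. mdist m (\<iota> x) (\<iota> y) = d x y)"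

lemma metric_completion_exists:
  fixes M :: "'x set"
  assumes "Metric_space M d"
  shows "\<exists>(m :: ('x \<Rightarrow> real) metric) \<iota>. is_metric_completion M d m \<iota>"
  using Metric_space.metric_completion[OF assms] unfolding is_metric_completion_def by metis


section \<open>Cayley graphs and word metrics\<close>

definition sym_gens :: "('a, 'm) monoid_scheme \<Rightarrow> 'a set \<Rightarrow> 'a set" where
  "sym_gens G A = A \<union> (\<lambda>a. inv\<^bsub>G\<^esub> a) ` A"

definition finite_gen_set :: "('a, 'm) monoid_scheme \<Rightarrow> 'a set \<Rightarrow> bool" where
  "finite_gen_set G A \<longleftrightarrow> finite A \<and> A \<subseteq> carrier G \<and> generate G A = carrier G"

definition cayley_edges :: "('a, 'm) monoid_scheme \<Rightarrow> 'a set \<Rightarrow> 'a rel" where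
  "cayley_edges G A = {(g, g \<otimes>\<^bsub>G\<^esub> a) | g a. g \<in> carrier G \<and> a \<in> sym_gens G A}"

definition word_dist :: "('a, 'm) monoid_scheme \<Rightarrow> 'a set \<Rightarrow> 'a \<Rightarrow> 'a \<Rightarrow> real" where
  "word_dist G A g h = real (LEAST n. (g, h) \<in> cayley_edges G A ^^ n)"

text \<open>
  Points of the geometric realization are given by barycentric coordinates: a point is a
  function \<open>w\<close> with nonnegative values of sum 1, supported on a cell, i.e. on a single vertex or
  on the two ends of an edge; a vertex \<open>g\<close> is the indicator function of \<open>{g}\<close>.
  The edge \<open>g \<rightarrow> ga\<close> and its inverse \<open>ga \<rightarrow> g\<close> are thereby one segment, and the loops
  \<open>g \<rightarrow> g\<close> that appear when \<open>A\<close> contains the identity contribute nothing but their vertex.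
\<close>

definition cayley_cells :: "('a, 'm) monoid_scheme \<Rightarrow> 'a set \<Rightarrow> 'a set set" where
  "cayley_cells G A = {{g} | g. g \<in> carrier G} \<union> {{g, h} | g h. (g, h) \<in> cayley_edges G A}"

definition supp :: "('a \<Rightarrow> real) \<Rightarrow> 'a set" where
  "supp w = {u. w u \<noteq> 0}"

definition cayley_points :: "('a, 'm) monoid_scheme \<Rightarrow> 'a set \<Rightarrow> ('a \<Rightarrow> real) set" where
  "cayley_points G A =
     {w. (\<forall>u. 0 \<le> w u) \<and> (\<exists>c\<in>cayley_cells G A. supp w \<subseteq> c \<and> sum w c = 1)}"

definition vert :: "'a \<Rightarrow> 'a \<Rightarrow> real" where
  "vert g = indicator {g}"

text \<open>
  The path metric for which every edge is isometric to the unit interval. Two points of a common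
  cell have distance half the \<open>l\<^sup>1\<close>-distance of their coordinates. Otherwise a shortest path
  leaves the cell of \<open>w\<close> through an end \<open>u\<close>, at distance \<open>1 - w u\<close> from \<open>w\<close>, and enters that of
  \<open>w'\<close> through an end \<open>v\<close>.
\<close>

definition cayley_dist ::
    "('a, 'm) monoid_scheme \<Rightarrow> 'a set \<Rightarrow> ('a \<Rightarrow> real) \<Rightarrow> ('a \<Rightarrow> real) \<Rightarrow> real" where
  "cayley_dist G A w w' =
     (if \<exists>c\<in>cayley_cells G A. supp w \<union> supp w' \<subseteq> c
      then (\<Sum>u\<in>supp w \<union> supp w'. \<bar>w u - w' u\<bar>) / 2
      else Min {(1 - w u) + word_dist G A u v + (1 - w' v) | u v. u \<in> supp w \<and> v \<in> supp w'})"

lemma cayley_edges_sym: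
  assumes "group G" "A \<subseteq> carrier G" "(g, h) \<in> cayley_edges G A"
  shows "(h, g) \<in> cayley_edges G A"
proof -
  interpret group G by fact
  obtain a where g: "g \<in> carrier G" and a: "a \<in> sym_gens G A" and h: "h = g \<otimes>\<^bsub>G\<^esub> a"
    using assms(3) by (auto simp: cayley_edges_def)
  have ac: "a \<in> carrier G" and inv: "inv\<^bsub>G\<^esub> a \<in> sym_gens G A"
    using a assms(2) by (auto simp: sym_gens_def subset_iff)
  have "g = h \<otimes>\<^bsub>G\<^esub> inv\<^bsub>G\<^esub> a"
    using g ac h by (simp add: m_assoc)
  moreover have "h \<in> carrier G"
    using g ac h by simp
  ultimately show ?thesis
    using inv unfolding cayley_edges_def by blast
qed

lemma cayley_dist_vert:
  assumes "group G" "A \<subseteq> carrier G" "g \<in> carrier G"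
  shows "cayley_dist G A (vert g) (vert h) = word_dist G A g h"
proof -
  have supp: "supp (vert x) = {x}" for x :: 'a
    by (auto simp: supp_def vert_def indicator_def)
  consider "g = h" | "g \<noteq> h" "\<exists>c\<in>cayley_cells G A. {g, h} \<subseteq> c"
    | "\<not> (\<exists>c\<in>cayley_cells G A. {g, h} \<subseteq> c)"
    by blast
  then show ?thesis
  proof cases
    case 1
    have "{g} \<in> cayley_cells G A"
      using assms by (auto simp: cayley_cells_def)
    moreover have "(LEAST n. (h, h) \<in> cayley_edges G A ^^ n) = 0"
      by (rule Least_equality) auto
    ultimately show ?thesis
      using 1 by (auto simp: cayley_dist_def supp word_dist_def)
  next
    case 2
    then have edge: "(g, h) \<in> cayley_edges G A"
      using cayley_edges_sym[OF assms(1,2)] by (auto simp: cayley_cells_def)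
    have "(LEAST n. (g, h) \<in> cayley_edges G A ^^ n) = 1"
    proof (rule Least_equality)
      show "(g, h) \<in> cayley_edges G A ^^ 1"
        using edge by simp
      show "1 \<le> n" if "(g, h) \<in> cayley_edges G A ^^ n" for n
        using that 2(1) by (cases n) simp_all
    qed
    moreover have "cayley_dist G A (vert g) (vert h) = (\<Sum>u\<in>{g, h}. \<bar>vert g u - vert h u\<bar>) / 2"
      using 2(2) by (simp add: cayley_dist_def supp insert_commute)
    ultimately show ?thesis
      using 2(1) by (simp add: word_dist_def vert_def)
  next
    case 3
    then have "cayley_dist G A (vert g) (vert h) = Min {(1 - vert g u) + word_dist G A u v + (1 - vert h v)
        | u v. u \<in> {g} \<and> v \<in> {h}}"
      unfolding cayley_dist_def supp insert_is_Un[symmetric] by (rule if_not_P)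
    moreover have "{(1 - vert g u) + word_dist G A u v + (1 - vert h v) | u v. u \<in> {g} \<and> v \<in> {h}}
        = {word_dist G A g h}"
      by (simp add: vert_def)
    ultimately show ?thesis
      by simp
  qed
qed


section \<open>Hyperbolic groups and visual metrics\<close>

definition hyperbolic_group :: "('a, 'm) monoid_scheme \<Rightarrow> 'a set \<Rightarrow> bool" where
  "hyperbolic_group G A \<longleftrightarrow>
     group G \<and> finite_gen_set G A \<and>
     (\<exists>\<delta>\<ge>0. delta_hyperbolic (cayley_points G A) (cayley_dist G A) \<delta>)"

definition quasiconvex_subgroup :: "('a, 'm) monoid_scheme \<Rightarrow> 'a set \<Rightarrow> 'a set \<Rightarrow> bool" where
  "quasiconvex_subgroup G A H \<longleftrightarrow>
     subgroup H G \<and>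
     (\<exists>q\<ge>0. \<forall>g\<in>H. \<forall>h\<in>H. \<forall>S.
        geodesic_segment (cayley_points G A) (cayley_dist G A) (vert g) (vert h) S \<longrightarrow>
          (\<forall>x\<in>S. dist_to_set (cayley_dist G A) x (vert ` H) \<le> q))"

definition gromov_product ::
    "('a, 'm) monoid_scheme \<Rightarrow> 'a set \<Rightarrow> 'a \<Rightarrow> 'a \<Rightarrow> 'a \<Rightarrow> real" where
  "gromov_product G A p g h =
     (word_dist G A p g + word_dist G A p h - word_dist G A g h) / 2"

definition visual_rho ::
    "('a, 'm) monoid_scheme \<Rightarrow> 'a set \<Rightarrow> 'a \<Rightarrow> real \<Rightarrow> 'a \<Rightarrow> 'a \<Rightarrow> real" where
  "visual_rho G A p \<gamma> g h = (if g \<noteq> h then exp (- \<gamma> * gromov_product G A p g h) else 0)"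

definition visual_metrics ::
    "('a, 'm) monoid_scheme \<Rightarrow> 'a set \<Rightarrow> 'a \<Rightarrow> real \<Rightarrow> real \<Rightarrow> ('a \<Rightarrow> 'a \<Rightarrow> real) set" where
  "visual_metrics G A p \<gamma> T =
     {d. Metric_space (carrier G) d \<and>
         (\<forall>g\<in>carrier G. \<forall>h\<in>carrier G. g \<noteq> h \<longrightarrow>
            1 / T * visual_rho G A p \<gamma> g h \<le> d g h \<and> d g h \<le> T * visual_rho G A p \<gamma> g h)}"

definition virtually_injective :: "('a, 'm) monoid_scheme \<Rightarrow> ('a \<Rightarrow> 'a) \<Rightarrow> bool" where
  "virtually_injective G \<phi> \<longleftrightarrow> finite (kernel G G \<phi>)"

end

theory Submission
  imports Defs
begin

text \<open>
  The implications (iv) to (i) and (iv) to (v) would classically use the stability of quasigeodesics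
  in hyperbolic spaces. Here the mere existence of a visual metric \<open>d\<close> replaces it: applying the
  triangle inequality of \<open>d\<close> along a quasigeodesic that stays at word distance \<open>R\<close> from the base
  point bounds the visual distance of its ends by a geometric series of size \<open>C exp (- \<gamma> R / 3)\<close>.
  For the image of a geodesic \<open>[g, h]\<close> this is the Hoelder condition, as \<open>[g, h]\<close> stays at distance
  \<open>(g|h)\<close> from the base point. For quasiconvexity, a vertex near a geodesic \<open>[g\<phi>, h\<phi>]\<close> is
  translated to the base point; the visual distance of the translated ends is then bounded below, so
  the quasigeodesic must pass nearby. For (v) to (iv), the vertices of a geodesic \<open>[g\<phi>, h\<phi>]\<close>
  are approximated by elements of \<open>G\<phi>\<close>, whose successive quotients lie in a finite set and hence
  have preimages of bounded length.
\<close>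

section \<open>Hoelder maps and completions\<close>

text \<open>The points are picked from balls of radius \<open>1 / (n + 1)\<close> around
  \<open>x\<close>. Convergence is stated through distances, the form in which
  \<open>ucmap_A\<close> transports it along uniformly continuous maps.\<close>

lemma dense_sequence:
  assumes "mtopology_of m closure_of S = mspace m" "x \<in> mspace m"
  obtains \<sigma> where "\<And>n. \<sigma> n \<in> S \<inter> mspace m" "(\<lambda>n. mdist m (\<sigma> n) x) \<longlonglongrightarrow> 0"
proof -
  interpret Metric_space "mspace m" "mdist m"
    by simp
  have "\<forall>r>0. \<exists>y\<in>S. y \<in> mball x r"
    using assms by (auto simp: mtopology_of_def metric_closure_of)
  then have "\<forall>n. \<exists>y. y \<in> S \<inter> mspace m \<and> mdist m y x < inverse (real (Suc n))"
    by (metis Int_iff commute in_mball inverse_positive_iff_positive of_nat_0_less_iff zero_less_Suc)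
  then obtain \<sigma> where \<sigma>: "\<And>n. \<sigma> n \<in> S \<inter> mspace m \<and> mdist m (\<sigma> n) x < inverse (real (Suc n))"
    by metis
  then have "(\<lambda>n. mdist m (\<sigma> n) x) \<longlonglongrightarrow> 0"
    by (intro tendsto_sandwich[OF _ _ tendsto_const LIMSEQ_inverse_real_of_nat])
      (auto intro!: always_eventually less_imp_le)
  with \<sigma> that show thesis
    by blast
qed

text \<open>By the triangle inequality, moving two points changes their distance by at most the sum
  of the two displacements.\<close>

lemma mdist_tendsto:
  assumes "\<And>n. \<sigma> n \<in> mspace m" "\<And>n. \<tau> n \<in> mspace m" "x \<in> mspace m" "y \<in> mspace m"
    and "(\<lambda>n. mdist m (\<sigma> n) x) \<longlonglongrightarrow> 0" "(\<lambda>n. mdist m (\<tau> n) y) \<longlonglongrightarrow> 0"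
  shows "(\<lambda>n. mdist m (\<sigma> n) (\<tau> n)) \<longlonglongrightarrow> mdist m x y"
proof (rule LIM_zero_cancel, rule Lim_null_comparison)
  interpret Metric_space "mspace m" "mdist m"
    by simp
  have "\<bar>mdist m (\<sigma> n) (\<tau> n) - mdist m x y\<bar> \<le> mdist m (\<sigma> n) x + mdist m (\<tau> n) y" for n
  proof -
    have "mdist m (\<sigma> n) (\<tau> n) \<le> mdist m (\<sigma> n) x + mdist m x (\<tau> n)"
      "mdist m x (\<tau> n) \<le> mdist m x y + mdist m y (\<tau> n)"
      "mdist m x y \<le> mdist m x (\<sigma> n) + mdist m (\<sigma> n) y"
      "mdist m (\<sigma> n) y \<le> mdist m (\<sigma> n) (\<tau> n) + mdist m (\<tau> n) y"
      using assms by (auto intro!: triangle)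
    then show ?thesis
      by (simp add: commute[of y] commute[of x "\<sigma> n"])
  qed
  then show "\<forall>\<^sub>F n in sequentially.
      norm (mdist m (\<sigma> n) (\<tau> n) - mdist m x y) \<le> mdist m (\<sigma> n) x + mdist m (\<tau> n) y"
    by simp
  show "(\<lambda>n. mdist m (\<sigma> n) x + mdist m (\<tau> n) y) \<longlonglongrightarrow> 0"
    using tendsto_add[OF assms(5,6)] by simp
qed

text \<open>Points closer than \<open>(\<epsilon> / K) powr (1 / r)\<close> have images closer than
  \<open>\<epsilon>\<close>. Uniform continuity is what allows a map to be extended to a
  completion.\<close>

lemma holder_condition_imp_uniformly_continuous_map:
  assumes "holder_condition (mspace m) (mdist m) (mdist m') f" "f \<in> mspace m \<rightarrow> mspace m'"
  shows "uniformly_continuous_map m m' f"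
proof -
  obtain r K where rK: "r > 0" "K > 0"
      "\<And>x y. x \<in> mspace m \<Longrightarrow> y \<in> mspace m \<Longrightarrow> mdist m' (f x) (f y) \<le> K * mdist m x y powr r"
    using assms(1) unfolding holder_condition_def by blast
  have "mdist m' (f y) (f x) < \<epsilon>"
    if "\<epsilon> > 0" "x \<in> mspace m" "y \<in> mspace m" "mdist m y x < (\<epsilon> / K) powr (1 / r)" for \<epsilon> x y
  proof -
    have "mdist m y x powr r < ((\<epsilon> / K) powr (1 / r)) powr r"
      using that rK by (intro powr_less_mono2) auto
    also have "\<dots> = \<epsilon> / K"
      using that rK by (simp add: powr_powr)
    finally have "K * mdist m y x powr r < \<epsilon>"
      using rK by (simp add: field_simps)
    with rK(3)[OF that(3,2)] show ?thesis
      by simp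
  qed
  then show ?thesis
    using assms(2) rK(1,2) unfolding uniformly_continuous_map_def
    by (metis divide_pos_pos powr_gt_zero less_irrefl)
qed

text \<open>A Hoelder map on the dense copy of \<open>M\<close> is uniformly continuous and so
  extends to the closure; its inequality survives the passage to limits with the same
  \<open>r\<close> and \<open>K\<close>. Conversely, the inequality restricts along the isometry
  \<open>\<iota>\<close>.\<close>

lemma holder_condition_iff_extension:
  assumes "Metric_space M d" "is_metric_completion M d m \<iota>" "f \<in> M \<rightarrow> M"
  shows "holder_condition M d d f \<longleftrightarrow>
    (\<exists>\<Phi>. \<Phi> \<in> mspace m \<rightarrow> mspace m \<and> (\<forall>x\<in>M. \<Phi> (\<iota> x) = \<iota> (f x)) \<and>
      holder_condition (mspace m) (mdist m) (mdist m) \<Phi>)" (is "?L \<longleftrightarrow> ?R")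
proof
  interpret Metric_space M d
    by fact
  have compl: "mcomplete_of m" "\<iota> \<in> M \<rightarrow> mspace m" "mtopology_of m closure_of (\<iota> ` M) = mspace m"
    and iso: "\<And>x y. x \<in> M \<Longrightarrow> y \<in> M \<Longrightarrow> mdist m (\<iota> x) (\<iota> y) = d x y"
    using assms(2) unfolding is_metric_completion_def by auto
  show ?L if ?R
  proof -
    obtain \<Phi> r K where "\<And>x. x \<in> M \<Longrightarrow> \<Phi> (\<iota> x) = \<iota> (f x)" and rK: "r > 0" "K > 0"
      "\<And>x y. x \<in> mspace m \<Longrightarrow> y \<in> mspace m \<Longrightarrow> mdist m (\<Phi> x) (\<Phi> y) \<le> K * mdist m x y powr r"
      using \<open>?R\<close> unfolding holder_condition_def by blast
    then have "d (f x) (f y) \<le> K * d x y powr r" if "x \<in> M" "y \<in> M" for x y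
      using that compl(2) iso[OF that] iso[of "f x" "f y"] assms(3) rK(3)[of "\<iota> x" "\<iota> y"]
      by (auto simp: Pi_iff)
    with rK show ?thesis
      unfolding holder_condition_def by blast
  qed
  show ?R if ?L
  proof -
    obtain r K where rK: "r > 0" "K > 0" "\<And>x y. x \<in> M \<Longrightarrow> y \<in> M \<Longrightarrow> d (f x) (f y) \<le> K * d x y powr r"
      using \<open>?L\<close> unfolding holder_condition_def by blast
    have inj: "inj_on \<iota> M"
      by (metis inj_onI iso mdist_zero zero)
    \<comment> \<open>\<open>F\<close> is \<open>f\<close> transported to the dense copy of
      \<open>M\<close>, which works because an isometry is injective.\<close>
    define F where "F = \<iota> \<circ> f \<circ> inv_into M \<iota>"
    have F: "F (\<iota> x) = \<iota> (f x)" if "x \<in> M" for x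
      using that inj by (simp add: F_def)
    have sp: "mspace (submetric m (\<iota> ` M)) = \<iota> ` M"
      using compl(2) by auto
    have "holder_condition (\<iota> ` M) (mdist m) (mdist m) F"
      unfolding holder_condition_def using rK F iso assms(3)
      by (intro exI[of _ r] exI[of _ K] conjI ballI) (auto simp: Pi_iff)
    moreover have "F \<in> \<iota> ` M \<rightarrow> mspace m"
      using F assms(3) compl(2) by auto
    ultimately have "uniformly_continuous_map (submetric m (\<iota> ` M)) m F"
      by (intro holder_condition_imp_uniformly_continuous_map) (simp_all add: sp del: mspace_submetric)
    then obtain \<Phi> where \<Phi>: "uniformly_continuous_map m m \<Phi>" "\<And>x. x \<in> \<iota> ` M \<Longrightarrow> \<Phi> x = F x"
      using uniformly_continuous_map_extends_to_closure_of[OF compl(1)] compl(3)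
      by (metis submetric_mspace)
    have \<Phi>sp: "\<Phi> \<in> mspace m \<rightarrow> mspace m"
      using \<Phi>(1) by (rule uniformly_continuous_map_funspace)
    have "mdist m (\<Phi> x) (\<Phi> y) \<le> K * mdist m x y powr r" if x: "x \<in> mspace m" and y: "y \<in> mspace m" for x y
    proof -
      obtain \<sigma> where \<sigma>: "\<And>n. \<sigma> n \<in> \<iota> ` M \<inter> mspace m" "(\<lambda>n. mdist m (\<sigma> n) x) \<longlonglongrightarrow> 0"
        using dense_sequence[OF compl(3) x] by blast
      obtain \<tau> where \<tau>: "\<And>n. \<tau> n \<in> \<iota> ` M \<inter> mspace m" "(\<lambda>n. mdist m (\<tau> n) y) \<longlonglongrightarrow> 0"
        using dense_sequence[OF compl(3) y] by blast
      have "(\<lambda>n. mdist m (\<Phi> (\<sigma> n)) (\<Phi> x)) \<longlonglongrightarrow> 0" "(\<lambda>n. mdist m (\<Phi> (\<tau> n)) (\<Phi> y)) \<longlonglongrightarrow> 0"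
        using ucmap_A[OF \<Phi>(1) \<sigma>(2)] ucmap_A[OF \<Phi>(1) \<tau>(2)] \<sigma>(1) \<tau>(1) x y by auto
      then have lim: "(\<lambda>n. mdist m (\<Phi> (\<sigma> n)) (\<Phi> (\<tau> n))) \<longlonglongrightarrow> mdist m (\<Phi> x) (\<Phi> y)"
        using \<Phi>sp \<sigma>(1) \<tau>(1) x y by (intro mdist_tendsto) auto
      have "(\<lambda>n. mdist m (\<sigma> n) (\<tau> n)) \<longlonglongrightarrow> mdist m x y"
        using \<sigma> \<tau> x y by (intro mdist_tendsto) auto
      \<comment> \<open>As \<open>r > 0\<close>, the power function is continuous on the nonnegative
        reals including 0, so the case \<open>x = y\<close> is covered.\<close>
      then have lim': "(\<lambda>n. K * mdist m (\<sigma> n) (\<tau> n) powr r) \<longlonglongrightarrow> K * mdist m x y powr r"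
        using rK(1) by (intro tendsto_mult_left tendsto_powr2) (auto intro: tendsto_const)
      have "mdist m (\<Phi> (\<sigma> n)) (\<Phi> (\<tau> n)) \<le> K * mdist m (\<sigma> n) (\<tau> n) powr r" for n
      proof -
        obtain a b where "a \<in> M" "b \<in> M" "\<sigma> n = \<iota> a" "\<tau> n = \<iota> b"
          using \<sigma>(1)[of n] \<tau>(1)[of n] by auto
        then show ?thesis
          using \<Phi>(2) F iso rK(3) assms(3) by (auto simp: Pi_iff)
      qed
      with lim lim' show ?thesis
        by (meson LIMSEQ_le)
    qed
    then have "holder_condition (mspace m) (mdist m) (mdist m) \<Phi>"
      using rK(1,2) unfolding holder_condition_def by blast
    then show ?thesis
      using \<Phi>sp \<Phi>(2) F by (intro exI[of _ \<Phi>]) simp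
  qed
qed

section \<open>Geometric sums and chains of points\<close>

text \<open>Distinct exponents make this a finite subsum of the full geometric series, whose terms
  are nonnegative.\<close>

lemma sum_power_inj_le:
  fixes q :: real
  assumes "0 \<le> q" "q < 1" "finite S" "inj_on f S"
  shows "(\<Sum>i\<in>S. q ^ f i) \<le> 1 / (1 - q)"
proof -
  have "(\<Sum>i\<in>S. q ^ f i) = (\<Sum>k\<in>f ` S. q ^ k)"
    using assms by (simp add: sum.reindex)
  also have "\<dots> \<le> (\<Sum>k. q ^ k)"
    using assms by (intro sum_le_suminf summable_geometric) auto
  also have "\<dots> = 1 / (1 - q)"
    using assms by (intro suminf_geometric) auto
  finally show ?thesis .
qed

text \<open>On either side of \<open>j\<close> the exponents are distinct natural numbers, so each
  side is bounded by a full geometric series. The bound depends neither on \<open>n\<close> nor on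
  \<open>j\<close>.\<close>

lemma sum_powr_abs_diff_le:
  fixes q :: real
  assumes "0 < q" "q < 1"
  shows "(\<Sum>i<n. q powr \<bar>real i - real j\<bar>) \<le> 2 / (1 - q)"
proof -
  have "(\<Sum>i<n. q powr \<bar>real i - real j\<bar>) =
      (\<Sum>i\<in>{..<n} \<inter> {..<j}. q powr \<bar>real i - real j\<bar>) + (\<Sum>i\<in>{..<n} - {..<j}. q powr \<bar>real i - real j\<bar>)"
    by (rule sum.Int_Diff) simp
  also have "(\<Sum>i\<in>{..<n} \<inter> {..<j}. q powr \<bar>real i - real j\<bar>) = (\<Sum>i\<in>{..<n} \<inter> {..<j}. q ^ (j - i))"
    using assms by (intro sum.cong) (auto simp flip: powr_realpow)
  also have "(\<Sum>i\<in>{..<n} - {..<j}. q powr \<bar>real i - real j\<bar>) = (\<Sum>i\<in>{..<n} - {..<j}. q ^ (i - j))"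
    using assms by (intro sum.cong) (auto simp flip: powr_realpow)
  also have "(\<Sum>i\<in>{..<n} \<inter> {..<j}. q ^ (j - i)) + (\<Sum>i\<in>{..<n} - {..<j}. q ^ (i - j)) \<le> 1 / (1 - q) + 1 / (1 - q)"
    using assms by (intro add_mono sum_power_inj_le) (auto simp: inj_on_def)
  finally show ?thesis
    by simp
qed

lemma (in Metric_space) chain_triangle:
  assumes "\<And>i. i \<le> n \<Longrightarrow> x i \<in> M"
  shows "d (x 0) (x n) \<le> (\<Sum>i<n. d (x i) (x (Suc i)))"
  using assms
proof (induction n)
  case (Suc n)
  have "d (x 0) (x (Suc n)) \<le> d (x 0) (x n) + d (x n) (x (Suc n))"
    using Suc.prems by (intro triangle) auto
  also have "d (x 0) (x n) \<le> (\<Sum>i<n. d (x i) (x (Suc i)))"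
    using Suc by auto
  finally show ?case
    by simp
qed simp

section \<open>Word metrics\<close>

locale fg_group = group G for G (structure) +
  fixes A
  assumes finite_gen_set: "finite_gen_set G A"
begin

abbreviation E where "E \<equiv> cayley_edges G A"
abbreviation D where "D \<equiv> word_dist G A"

lemma gens_closed: "A \<subseteq> carrier G" and finite_gens: "finite A" and generate_gens: "generate G A = carrier G"
  using finite_gen_set by (auto simp: finite_gen_set_def)

lemma sym_gens_closed: "sym_gens G A \<subseteq> carrier G"
  using gens_closed by (auto simp: sym_gens_def)

lemma finite_sym_gens: "finite (sym_gens G A)"
  using finite_gens by (simp add: sym_gens_def)

lemma edge_iff: "(g, h) \<in> E \<longleftrightarrow> g \<in> carrier G \<and> (\<exists>a\<in>sym_gens G A. h = g \<otimes> a)"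
  by (auto simp: cayley_edges_def)

lemma edge_closed: "(g, h) \<in> E \<Longrightarrow> g \<in> carrier G \<and> h \<in> carrier G"
  using sym_gens_closed by (auto simp: edge_iff)

lemma edge_sym: "(g, h) \<in> E \<Longrightarrow> (h, g) \<in> E"
  using cayley_edges_sym[OF is_group gens_closed] .

lemma edge_translate: "(g, h) \<in> E \<Longrightarrow> x \<in> carrier G \<Longrightarrow> (x \<otimes> g, x \<otimes> h) \<in> E"
  using sym_gens_closed by (auto simp: edge_iff m_assoc subset_iff)

lemma relpow_edge_sym: "(g, h) \<in> E ^^ n \<Longrightarrow> (h, g) \<in> E ^^ n"
proof (induction n arbitrary: h)
  case (Suc n)
  then show ?case
    by (meson edge_sym relpow_Suc_E relpow_Suc_I2)
qed simp

lemma relpow_edge_translate: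
  assumes "x \<in> carrier G"
  shows "(g, h) \<in> E ^^ n \<Longrightarrow> (x \<otimes> g, x \<otimes> h) \<in> E ^^ n"
proof (induction n arbitrary: h)
  case (Suc n)
  then show ?case
    using assms by (meson edge_translate relpow_Suc_E relpow_Suc_I)
qed simp

text \<open>By induction on the generation of \<open>g\<close>: a path to
  \<open>h1 \<otimes> h2\<close> is a path to \<open>h1\<close> followed by the translate by
  \<open>h1\<close> of a path to \<open>h2\<close>.\<close>

lemma reachable_one:
  assumes "g \<in> carrier G"
  shows "\<exists>n. (\<one>, g) \<in> E ^^ n"
proof -
  have "g \<in> generate G A"
    using assms by (simp add: generate_gens)
  then show ?thesis
  proof (induction rule: generate.induct)
    case one
    show ?case
      by (rule exI[of _ 0]) simp
  next
    case (incl h)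
    then have "(\<one>, h) \<in> E ^^ 1"
      using gens_closed by (auto simp: edge_iff sym_gens_def intro!: bexI[of _ h])
    then show ?case
      by blast
  next
    case (inv h)
    then have "(\<one>, inv h) \<in> E ^^ 1"
      using gens_closed by (auto simp: edge_iff sym_gens_def intro!: bexI[of _ "inv h"])
    then show ?case
      by blast
  next
    case (eng h1 h2)
    then obtain m n where "(\<one>, h1) \<in> E ^^ m" "(\<one>, h2) \<in> E ^^ n"
      by blast
    moreover have "h1 \<in> carrier G"
      using eng generate_gens by blast
    ultimately have "(\<one>, h1 \<otimes> h2) \<in> E ^^ (m + n)"
      using relpow_edge_translate[of h1 \<one> h2 n] by (auto intro: relpow_trans)
    then show ?case
      by blast
  qed
qed

lemma reachable:
  assumes "g \<in> carrier G" "h \<in> carrier G"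
  shows "\<exists>n. (g, h) \<in> E ^^ n"
  using reachable_one[of "inv g \<otimes> h"] relpow_edge_translate[OF assms(1), of \<one> "inv g \<otimes> h"] assms
  by (auto simp flip: m_assoc)

lemma word_dist_le: "(g, h) \<in> E ^^ n \<Longrightarrow> D g h \<le> real n"
  unfolding word_dist_def by (simp add: Least_le)

lemma word_dist_path:
  assumes "g \<in> carrier G" "h \<in> carrier G"
  obtains n where "(g, h) \<in> E ^^ n" "D g h = real n"
  using LeastI_ex[OF reachable[OF assms]] that unfolding word_dist_def by blast

lemma word_dist_nonneg: "0 \<le> D g h"
  by (simp add: word_dist_def)

lemma word_dist_refl: "D g g = 0"
  using word_dist_le[of g g 0] word_dist_nonneg[of g g] by simp

lemma word_dist_sym:
  assumes "g \<in> carrier G" "h \<in> carrier G"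
  shows "D g h = D h g"
proof -
  have "(g, h) \<in> E ^^ n \<longleftrightarrow> (h, g) \<in> E ^^ n" for n
    using relpow_edge_sym by blast
  then show ?thesis
    by (simp add: word_dist_def)
qed

lemma word_dist_triangle:
  assumes "g \<in> carrier G" "h \<in> carrier G" "k \<in> carrier G"
  shows "D g k \<le> D g h + D h k"
proof -
  obtain m where m: "(g, h) \<in> E ^^ m" "D g h = real m"
    using word_dist_path[OF assms(1,2)] .
  obtain n where n: "(h, k) \<in> E ^^ n" "D h k = real n"
    using word_dist_path[OF assms(2,3)] .
  then show ?thesis
    using word_dist_le[OF relpow_trans[OF m(1) n(1)]] m(2) n(2) by simp
qed

lemma word_dist_translate:
  assumes "x \<in> carrier G" "g \<in> carrier G" "h \<in> carrier G"
  shows "D (x \<otimes> g) (x \<otimes> h) = D g h"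
proof -
  have "(x \<otimes> g, x \<otimes> h) \<in> E ^^ n \<longleftrightarrow> (g, h) \<in> E ^^ n" for n
    using relpow_edge_translate[of x g h n] relpow_edge_translate[of "inv x" "x \<otimes> g" "x \<otimes> h" n] assms
    by (auto simp flip: m_assoc)
  then show ?thesis
    by (simp add: word_dist_def)
qed

lemma word_dist_one:
  assumes "g \<in> carrier G" "h \<in> carrier G"
  shows "D g h = D \<one> (inv g \<otimes> h)"
  using word_dist_translate[of "inv g" g h] assms by simp

lemma edge_if_word_dist_eq_1:
  assumes "g \<in> carrier G" "h \<in> carrier G" "D g h = 1"
  shows "(g, h) \<in> E"
  using word_dist_path[OF assms(1,2)] assms(3) by (metis of_nat_eq_1_iff relpow_1)

lemma word_dist_edge_le: "(g, h) \<in> E \<Longrightarrow> D g h \<le> 1"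
  using word_dist_le[of g h 1] by simp

lemma finite_relpow_image: "finite {g. (\<one>, g) \<in> E ^^ n}"
proof (induction n)
  case (Suc n)
  have "{g. (\<one>, g) \<in> E ^^ Suc n} \<subseteq> (\<lambda>(g, a). g \<otimes> a) ` ({g. (\<one>, g) \<in> E ^^ n} \<times> sym_gens G A)"
    by (fastforce simp: edge_iff)
  then show ?case
    by (rule finite_subset) (use Suc finite_sym_gens in auto)
qed simp

text \<open>Only finitely many words of each length exist. This makes the kernel finite in
  \<open>qi_imp_virtually_injective\<close> and the set \<open>F\<close> finite in
  \<open>quasiconvex_imp_qi\<close>.\<close>

lemma finite_ball: "finite {g \<in> carrier G. D \<one> g \<le> r}"
proof (rule finite_subset)
  show "{g \<in> carrier G. D \<one> g \<le> r} \<subseteq> (\<Union>n\<le>nat \<lfloor>r\<rfloor>. {g. (\<one>, g) \<in> E ^^ n})"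
  proof
    fix g assume g: "g \<in> {g \<in> carrier G. D \<one> g \<le> r}"
    then obtain n where "(\<one>, g) \<in> E ^^ n" "D \<one> g = real n"
      using word_dist_path[of \<one> g] by auto
    then show "g \<in> (\<Union>n\<le>nat \<lfloor>r\<rfloor>. {g. (\<one>, g) \<in> E ^^ n})"
      using g by (auto simp: le_nat_floor)
  qed
  show "finite (\<Union>n\<le>nat \<lfloor>r\<rfloor>. {g. (\<one>, g) \<in> E ^^ n})"
    using finite_relpow_image by auto
qed

lemma finite_word_dist_bound:
  assumes "finite S"
  obtains B where "B \<ge> 0" "\<And>g. g \<in> S \<Longrightarrow> D \<one> g \<le> B"
proof
  show "0 \<le> Max (insert 0 (D \<one> ` S))" "\<And>g. g \<in> S \<Longrightarrow> D \<one> g \<le> Max (insert 0 (D \<one> ` S))"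
    using assms by auto
qed

section \<open>Geodesics as vertex sequences\<close>

text \<open>Most arguments need only the vertices on a geodesic; segments of the geometric
  realization enter only through quasiconvexity. The values of \<open>v\<close> beyond
  \<open>n\<close> are arbitrary.\<close>

definition geodesic_word :: "(nat \<Rightarrow> 'a) \<Rightarrow> nat \<Rightarrow> bool" where
  "geodesic_word v n \<longleftrightarrow> (\<forall>i\<le>n. v i \<in> carrier G) \<and> (\<forall>i\<le>n. \<forall>j\<le>n. D (v i) (v j) = \<bar>real i - real j\<bar>)"

lemma geodesic_word_exists:
  assumes g: "g \<in> carrier G" and h: "h \<in> carrier G"
  obtains v n where "geodesic_word v n" "v 0 = g" "v n = h" "D g h = real n"
proof -
  obtain n where n: "(g, h) \<in> E ^^ n" "D g h = real n"
    using word_dist_path[OF assms] .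
  then obtain v where v: "v 0 = g" "v n = h" "\<And>i. i < n \<Longrightarrow> (v i, v (Suc i)) \<in> E"
    unfolding relpow_fun_conv by blast
  have cl: "v i \<in> carrier G" if "i \<le> n" for i
    using that v(2,3) h edge_closed[of "v i" "v (Suc i)"] by (cases "i = n") auto
  have up: "D (v i) (v j) \<le> real (j - i)" if "i \<le> j" "j \<le> n" for i j
  proof (rule word_dist_le)
    show "(v i, v j) \<in> E ^^ (j - i)"
      unfolding relpow_fun_conv using that v(3) by (intro exI[of _ "\<lambda>k. v (i + k)"]) auto
  qed
  have eq: "D (v i) (v j) = real j - real i" if "i \<le> j" "j \<le> n" for i j
  proof -
    \<comment> \<open>The three pieces have lengths at most \<open>i\<close>, \<open>j - i\<close>
      and \<open>n - j\<close>, which add up to \<open>n\<close>; since the whole path is shortest,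
      none of them can be shortened.\<close>
    have "real n \<le> D (v 0) (v i) + D (v i) (v n)"
      using n(2) v(1,2) word_dist_triangle[of g "v i" h] cl[of i] that g h by simp
    also have "D (v i) (v n) \<le> D (v i) (v j) + D (v j) (v n)"
      using that by (intro word_dist_triangle cl) auto
    finally show ?thesis
      using up[of 0 i] up[of i j] up[of j n] that by (simp add: of_nat_diff)
  qed
  have "D (v i) (v j) = \<bar>real i - real j\<bar>" if "i \<le> n" "j \<le> n" for i j
    using that eq[of i j] eq[of j i] word_dist_sym[OF cl[of i] cl[of j]] by (cases "i \<le> j") auto
  then have "geodesic_word v n"
    using cl by (simp add: geodesic_word_def)
  then show thesis
    using that v n by blast
qed

lemma geodesic_word_edge: "geodesic_word v n \<Longrightarrow> i < n \<Longrightarrow> (v i, v (Suc i)) \<in> E"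
  by (intro edge_if_word_dist_eq_1) (auto simp: geodesic_word_def)

lemma word_dist_edge_path_le:
  assumes "\<And>i. i \<le> n \<Longrightarrow> x i \<in> carrier G" "\<And>i. i < n \<Longrightarrow> D (x i) (x (Suc i)) \<le> M"
  shows "D (x 0) (x n) \<le> real n * M"
  using assms
proof (induction n)
  case (Suc n)
  have "D (x 0) (x (Suc n)) \<le> D (x 0) (x n) + D (x n) (x (Suc n))"
    using Suc.prems by (intro word_dist_triangle) auto
  also have "D (x 0) (x n) \<le> real n * M"
    using Suc by auto
  also have "D (x n) (x (Suc n)) \<le> M"
    using Suc by auto
  finally show ?case
    by (simp add: algebra_simps)
qed (simp add: word_dist_refl)

text \<open>The image of an edge has the length of the image of a generator, and these lengths are
  bounded by some \<open>B\<close>. The constant is kept at least 1 so that it can enter the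
  multiplicative constant of a quasi-isometric embedding.\<close>

lemma hom_lipschitz:
  assumes "\<phi> \<in> hom G G"
  obtains M where "M \<ge> 1" "\<And>g h. g \<in> carrier G \<Longrightarrow> h \<in> carrier G \<Longrightarrow> D (\<phi> g) (\<phi> h) \<le> M * D g h"
proof -
  have cl: "\<phi> g \<in> carrier G" if "g \<in> carrier G" for g
    using assms that by (auto simp: hom_def)
  obtain B where B: "B \<ge> 0" "\<And>b. b \<in> \<phi> ` sym_gens G A \<Longrightarrow> D \<one> b \<le> B"
    using finite_word_dist_bound[OF finite_imageI[OF finite_sym_gens, of \<phi>]] by metis
  have "D (\<phi> g) (\<phi> h) \<le> max 1 B * D g h" if gh: "g \<in> carrier G" "h \<in> carrier G" for g h
  proof -
    obtain v n where v: "geodesic_word v n" "v 0 = g" "v n = h" "D g h = real n"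
      using geodesic_word_exists[OF gh] .
    have "D (\<phi> (v i)) (\<phi> (v (Suc i))) \<le> B" if i: "i < n" for i
    proof -
      obtain a where a: "v i \<in> carrier G" "a \<in> sym_gens G A" "v (Suc i) = v i \<otimes> a"
        using geodesic_word_edge[OF v(1) i] unfolding edge_iff by blast
      have ac: "a \<in> carrier G"
        using a(2) sym_gens_closed by blast
      have "D (\<phi> (v i)) (\<phi> (v (Suc i))) = D (\<phi> (v i) \<otimes> \<one>) (\<phi> (v i) \<otimes> \<phi> a)"
        unfolding a(3) hom_mult[OF assms a(1) ac] using cl[OF a(1)] by simp
      also have "\<dots> = D \<one> (\<phi> a)"
        using a ac cl by (intro word_dist_translate) auto
      finally show ?thesis
        using B(2)[OF imageI[OF a(2)]] by simp
    qed
    then have "D (\<phi> (v 0)) (\<phi> (v n)) \<le> real n * B"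
      using v(1) cl
      by (intro word_dist_edge_path_le[where x = "\<lambda>i. \<phi> (v i)"]) (simp_all add: geodesic_word_def)
    also have "\<dots> \<le> max 1 B * D g h"
      using v(4) B(1) mult_right_mono[of B "max 1 B" "real n"] by (simp add: mult.commute)
    finally show ?thesis
      using v(2,3) by simp
  qed
  then show thesis
    by (intro that[of "max 1 B"]) simp_all
qed

section \<open>Elementary estimates for Gromov products\<close>

text \<open>For the two ends of a short step, the product is thus nearly bounded below by the
  distance from \<open>p\<close>, so steps far from \<open>p\<close> are visually small.\<close>

lemma gromov_product_ge:
  assumes "p \<in> carrier G" "g \<in> carrier G" "h \<in> carrier G"
  shows "D p g - D g h \<le> gromov_product G A p g h"
  using word_dist_triangle[OF assms(1,3,2)] word_dist_sym[OF assms(2,3)]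
  by (simp add: gromov_product_def field_simps)

text \<open>The distances from \<open>v i\<close> to both ends add up to the length of the geodesic;
  the two triangle inequalities through \<open>v i\<close> are then added.\<close>

lemma gromov_product_le_geodesic:
  assumes p: "p \<in> carrier G" and v: "geodesic_word v n" and i: "i \<le> n"
  shows "gromov_product G A p (v 0) (v n) \<le> D p (v i)"
proof -
  have cl: "v 0 \<in> carrier G" "v i \<in> carrier G" "v n \<in> carrier G"
    and "D (v i) (v 0) = real i" "D (v i) (v n) = real n - real i" "D (v 0) (v n) = real n"
    using v i by (auto simp: geodesic_word_def)
  then show ?thesis
    using word_dist_triangle[OF p cl(2) cl(1)] word_dist_triangle[OF p cl(2) cl(3)]
    by (simp add: gromov_product_def field_simps)
qed

text \<open>Used to replace \<open>g\<close> by a nearby element \<open>k\<close> at bounded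
  cost.\<close>

lemma gromov_product_lipschitz:
  assumes "p \<in> carrier G" "g \<in> carrier G" "h \<in> carrier G" "k \<in> carrier G"
  shows "gromov_product G A p g h \<le> gromov_product G A p k h + D g k"
  using word_dist_triangle[OF assms(1,4,2)] word_dist_triangle[OF assms(4,2,3)] word_dist_sym[OF assms(2,4)]
  by (simp add: gromov_product_def field_simps)

end

section \<open>Visual metrics and quasigeodesics\<close>

locale visual_group = fg_group +
  fixes p and \<gamma> T :: real and d
  assumes base: "p \<in> carrier G" and \<gamma>_pos: "\<gamma> > 0" and T_ge_1: "T \<ge> 1"
    and visual: "d \<in> visual_metrics G A p \<gamma> T"
begin

abbreviation gp where "gp \<equiv> gromov_product G A p"

lemma metric: "Metric_space (carrier G) d"
  using visual by (simp add: visual_metrics_def)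

text \<open>Equal points are allowed because \<open>d\<close> vanishes there; the lower bound below
  needs distinct points.\<close>

lemma visual_upper:
  assumes "g \<in> carrier G" "h \<in> carrier G"
  shows "d g h \<le> T * exp (- \<gamma> * gp g h)"
proof (cases "g = h")
  case True
  then show ?thesis
    using Metric_space.mdist_zero[OF metric assms(2)] T_ge_1 by simp
next
  case False
  then show ?thesis
    using visual assms by (simp add: visual_metrics_def visual_rho_def)
qed

lemma visual_lower:
  assumes "g \<in> carrier G" "h \<in> carrier G" "g \<noteq> h"
  shows "exp (- \<gamma> * gp g h) \<le> T * d g h"
  using visual assms T_ge_1 by (simp add: visual_metrics_def visual_rho_def field_simps)

text \<open>
  This replaces the stability of quasigeodesics. If the path comes closest to \<open>p\<close> at time \<open>j\<close>,
  then \<open>x i\<close> is at distance at least \<open>(R + \<bar>i - j\<bar> / L - K) / 3\<close> from \<open>p\<close>, so the visual lengths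
  of the steps are dominated by a geometric series.
\<close>

lemma quasigeodesic_visual_dist:
  fixes L M K :: real
  assumes L: "L > 0"
  shows "\<exists>C>0. \<forall>x n R. (\<forall>i\<le>n. x i \<in> carrier G) \<and> (\<forall>i<n. D (x i) (x (Suc i)) \<le> M) \<and>
      (\<forall>i\<le>n. \<forall>j\<le>n. \<bar>real i - real j\<bar> / L - K \<le> D (x i) (x j)) \<and>
      (\<forall>i\<le>n. R \<le> D p (x i)) \<longrightarrow> d (x 0) (x n) \<le> C * exp (- \<gamma> * R / 3)"
proof -
  \<comment> \<open>Both constants come from factoring the exponential of the lower bound for the
    Gromov product of a step: \<open>q\<close> carries the dependence on
    \<open>\<bar>i - j\<bar>\<close>, and \<open>B\<close> collects what depends on neither
    \<open>i\<close> nor \<open>R\<close>.\<close>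
  define q where "q = exp (- \<gamma> / (3 * L))"
  define B where "B = T * exp (\<gamma> * M + \<gamma> * K / 3)"
  have q: "0 < q" "q < 1"
    using \<gamma>_pos L by (auto simp: q_def)
  have B: "B > 0"
    using T_ge_1 by (auto simp: B_def)
  show ?thesis
  proof (intro exI[of _ "B * (2 / (1 - q))"] conjI allI impI)
    show "0 < B * (2 / (1 - q))"
      using q B by simp
    fix x :: "nat \<Rightarrow> 'a" and n :: nat and R :: real
    assume "(\<forall>i\<le>n. x i \<in> carrier G) \<and> (\<forall>i<n. D (x i) (x (Suc i)) \<le> M) \<and>
      (\<forall>i\<le>n. \<forall>j\<le>n. \<bar>real i - real j\<bar> / L - K \<le> D (x i) (x j)) \<and> (\<forall>i\<le>n. R \<le> D p (x i))"
    then have cl: "\<And>i. i \<le> n \<Longrightarrow> x i \<in> carrier G"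
      and step: "\<And>i. i < n \<Longrightarrow> D (x i) (x (Suc i)) \<le> M"
      and qg: "\<And>i j. i \<le> n \<Longrightarrow> j \<le> n \<Longrightarrow> \<bar>real i - real j\<bar> / L - K \<le> D (x i) (x j)"
      and R: "\<And>i. i \<le> n \<Longrightarrow> R \<le> D p (x i)"
      by auto
    obtain j where j: "j \<le> n" "\<And>i. i \<le> n \<Longrightarrow> D p (x j) \<le> D p (x i)"
      using ex_is_arg_min_if_finite[of "{..n}" "\<lambda>i. D p (x i)"] by (auto simp: is_arg_min_linorder)
    have step_bound: "d (x i) (x (Suc i)) \<le> B * exp (- \<gamma> * R / 3) * q powr \<bar>real i - real j\<bar>"
      if i: "i < n" for i
    proof -
      \<comment> \<open>By the choice of \<open>j\<close>, both distances on the right are at most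
        \<open>D p (x i)\<close>, and so is \<open>R\<close>. Adding the estimates gives the factor
        3.\<close>
      have "\<bar>real i - real j\<bar> / L - K \<le> D (x i) p + D p (x j)"
        using qg[of i j] word_dist_triangle[of "x i" p "x j"] cl base i j(1) by force
      moreover have "D (x i) p = D p (x i)"
        using word_dist_sym[OF base cl[of i]] i by simp
      ultimately have "(R + \<bar>real i - real j\<bar> / L - K) / 3 \<le> D p (x i)"
        using j(2)[of i] R[OF j(1)] i by simp
      also have "\<dots> - M \<le> gp (x i) (x (Suc i))"
        using gromov_product_ge[OF base cl[of i] cl[of "Suc i"]] step[OF i] i by simp
      finally have *: "(R + \<bar>real i - real j\<bar> / L - K) / 3 - M \<le> gp (x i) (x (Suc i))"
        by simp
      have "d (x i) (x (Suc i)) \<le> T * exp (- \<gamma> * gp (x i) (x (Suc i)))"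
        using cl i by (intro visual_upper) auto
      also have "\<dots> \<le> T * exp (- \<gamma> * ((R + \<bar>real i - real j\<bar> / L - K) / 3 - M))"
        using mult_left_mono[OF *, of \<gamma>] \<gamma>_pos T_ge_1 by (intro mult_left_mono) auto
      also have "- \<gamma> * ((R + \<bar>real i - real j\<bar> / L - K) / 3 - M)
          = (\<gamma> * M + \<gamma> * K / 3) + (- \<gamma> * R / 3) + \<bar>real i - real j\<bar> * (- \<gamma> / (3 * L))"
        using L by (simp add: field_simps)
      also have "T * exp \<dots> = B * exp (- \<gamma> * R / 3) * q powr \<bar>real i - real j\<bar>"
        by (simp only: B_def q_def powr_def exp_add ln_exp exp_not_eq_zero if_False mult.assoc)
      finally show ?thesis .
    qed
    have "d (x 0) (x n) \<le> (\<Sum>i<n. d (x i) (x (Suc i)))"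
      using cl by (intro Metric_space.chain_triangle[OF metric])
    also have "\<dots> \<le> (\<Sum>i<n. B * exp (- \<gamma> * R / 3) * q powr \<bar>real i - real j\<bar>)"
      by (intro sum_mono step_bound) auto
    also have "\<dots> = B * exp (- \<gamma> * R / 3) * (\<Sum>i<n. q powr \<bar>real i - real j\<bar>)"
      by (simp add: sum_distrib_left)
    also have "\<dots> \<le> B * exp (- \<gamma> * R / 3) * (2 / (1 - q))"
      using B by (intro mult_left_mono sum_powr_abs_diff_le q) auto
    finally show "d (x 0) (x n) \<le> B * (2 / (1 - q)) * exp (- \<gamma> * R / 3)"
      by (simp add: mult_ac)
  qed
qed

section \<open>Hoelder condition, Gromov products and quasi-isometric embeddings\<close>

text \<open>The image of a geodesic from \<open>g\<close> to \<open>h\<close> is a quasigeodesic at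
  distance at least \<open>gp g h / L - c\<close> from \<open>p\<close>. Its ends therefore have
  visual distance at most a constant times a power of \<open>exp (- \<gamma> * gp g h)\<close>,
  which is comparable to \<open>d g h\<close>.\<close>

lemma qi_imp_holder:
  assumes \<phi>: "\<phi> \<in> hom G G" and qi: "qi_embedding (carrier G) D D \<phi>"
  shows "holder_condition (carrier G) d d \<phi>"
proof -
  interpret m: Metric_space "carrier G" d
    by (rule metric)
  obtain L K where L: "L \<ge> 1" and
    lower: "\<And>g h. g \<in> carrier G \<Longrightarrow> h \<in> carrier G \<Longrightarrow> 1 / L * D g h - K \<le> D (\<phi> g) (\<phi> h)"
    using qi unfolding qi_embedding_def by blast
  have cl: "\<phi> g \<in> carrier G" if "g \<in> carrier G" for g
    using hom_in_carrier[OF \<phi> that] .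
  obtain M where lip: "\<And>g h. g \<in> carrier G \<Longrightarrow> h \<in> carrier G \<Longrightarrow> D (\<phi> g) (\<phi> h) \<le> M * D g h"
    using hom_lipschitz[OF \<phi>] by metis
  have Lpos: "L > 0"
    using L by simp
  obtain C where C: "C > 0"
    "\<And>x n R. (\<forall>i\<le>n. x i \<in> carrier G) \<and> (\<forall>i<n. D (x i) (x (Suc i)) \<le> M) \<and>
      (\<forall>i\<le>n. \<forall>j\<le>n. \<bar>real i - real j\<bar> / L - K \<le> D (x i) (x j)) \<and>
      (\<forall>i\<le>n. R \<le> D p (x i)) \<Longrightarrow> d (x 0) (x n) \<le> C * exp (- \<gamma> * R / 3)"
    using quasigeodesic_visual_dist[OF Lpos, of M K] by blast
  \<comment> \<open>The constant \<open>c\<close> also pays for \<open>\<phi>\<close> moving the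
    base point. In \<open>r\<close>, the factor \<open>1 / L\<close> comes from the embedding and
    \<open>1 / 3\<close> from the quasigeodesic estimate.\<close>
  define c where "c = K + D p (\<phi> p)"
  define r where "r = 1 / (3 * L)"
  define K' where "K' = C * exp (\<gamma> * c / 3) * T powr r"
  have "d (\<phi> g) (\<phi> h) \<le> K' * d g h powr r" if g: "g \<in> carrier G" and h: "h \<in> carrier G" for g h
  proof (cases "g = h")
    case True
    then show ?thesis
      using m.mdist_zero cl g by simp
  next
    case False
    obtain v n where v: "geodesic_word v n" "v 0 = g" "v n = h"
      using geodesic_word_exists[OF g h] .
    have vcl: "\<And>i. i \<le> n \<Longrightarrow> v i \<in> carrier G"
      and vd: "\<And>i j. i \<le> n \<Longrightarrow> j \<le> n \<Longrightarrow> D (v i) (v j) = \<bar>real i - real j\<bar>"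
      using v(1) by (auto simp: geodesic_word_def)
    have far: "gp g h / L - c \<le> D p (\<phi> (v i))" if i: "i \<le> n" for i
    proof -
      have "gp g h \<le> D p (v i)"
        using gromov_product_le_geodesic[OF base v(1) i] v(2,3) by simp
      then have "gp g h / L \<le> D p (v i) / L"
        using Lpos by (simp add: divide_right_mono)
      also have "D p (v i) / L - K \<le> D (\<phi> p) (\<phi> (v i))"
        using lower[OF base vcl[OF i]] by simp
      also have "D (\<phi> p) (\<phi> (v i)) \<le> D p (\<phi> p) + D p (\<phi> (v i))"
        using word_dist_triangle[of "\<phi> p" p "\<phi> (v i)"] word_dist_sym[OF base cl[OF base]] cl[OF vcl[OF i]] cl[OF base] base
        by simp
      finally show ?thesis
        by (simp add: c_def)
    qed
    have "d (\<phi> (v 0)) (\<phi> (v n)) \<le> C * exp (- \<gamma> * (gp g h / L - c) / 3)"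
    proof (intro C(2)[of n "\<lambda>i. \<phi> (v i)"] conjI allI impI)
      show "\<phi> (v i) \<in> carrier G" if "i \<le> n" for i
        using that vcl cl by blast
      show "D (\<phi> (v i)) (\<phi> (v (Suc i))) \<le> M" if "i < n" for i
        using lip[OF vcl[of i] vcl[of "Suc i"]] vd[of i "Suc i"] that by simp
      show "\<bar>real i - real j\<bar> / L - K \<le> D (\<phi> (v i)) (\<phi> (v j))" if "i \<le> n" "j \<le> n" for i j
        using lower[OF vcl[of i] vcl[of j]] vd[of i j] that by simp
    qed (rule far)
    also have "- \<gamma> * (gp g h / L - c) / 3 = \<gamma> * c / 3 + r * (- \<gamma> * gp g h)"
      using Lpos by (simp add: r_def field_simps)
    also have "C * exp \<dots> = C * exp (\<gamma> * c / 3) * exp (- \<gamma> * gp g h) powr r"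
      by (simp only: exp_add powr_def ln_exp exp_not_eq_zero if_False mult.assoc)
    also have "\<dots> \<le> C * exp (\<gamma> * c / 3) * (T * d g h) powr r"
      using C(1) Lpos visual_lower[OF g h False] by (intro mult_left_mono powr_mono2) (auto simp: r_def)
    also have "\<dots> = K' * d g h powr r"
      using T_ge_1 by (simp add: K'_def powr_mult)
    finally show ?thesis
      using v(2,3) by simp
  qed
  moreover have "K' > 0" "r > 0"
    using C(1) T_ge_1 Lpos by (auto simp: K'_def r_def)
  ultimately show ?thesis
    unfolding holder_condition_def by blast
qed

text \<open>Taking logarithms of the Hoelder inequality gives the linear bound whenever
  \<open>\<phi> g \<noteq> \<phi> h\<close>. If the images agree, \<open>g\<close> is first moved to
  \<open>g \<otimes> k\<close> with \<open>\<phi> k \<noteq> \<one>\<close>, which separates the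
  images and changes both products by a bounded amount.\<close>

lemma holder_imp_gromov_product_bound:
  assumes \<phi>: "\<phi> \<in> hom G G" and nontriv: "\<phi> ` carrier G \<noteq> {\<one>}"
    and holder: "holder_condition (carrier G) d d \<phi>"
  shows "\<exists>P Q. P > 0 \<and> (\<forall>g\<in>carrier G. \<forall>h\<in>carrier G. gp g h \<le> P * gp (\<phi> g) (\<phi> h) + Q)"
proof -
  interpret m: Metric_space "carrier G" d
    by (rule metric)
  have cl: "\<phi> g \<in> carrier G" if "g \<in> carrier G" for g
    using hom_in_carrier[OF \<phi> that] .
  obtain r K where r: "r > 0" and K: "K > 0"
    and hold: "\<And>g h. g \<in> carrier G \<Longrightarrow> h \<in> carrier G \<Longrightarrow> d (\<phi> g) (\<phi> h) \<le> K * d g h powr r"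
    using holder unfolding holder_condition_def by blast
  \<comment> \<open>The logarithm of the accumulated factor \<open>T * K * T powr r\<close>, divided
    by the coefficient of \<open>gp g h\<close>.\<close>
  define Q where "Q = ln (T * K * T powr r) / (\<gamma> * r)"
  have dist: "gp g h \<le> 1 / r * gp (\<phi> g) (\<phi> h) + Q"
    if g: "g \<in> carrier G" and h: "h \<in> carrier G" and ne: "\<phi> g \<noteq> \<phi> h" for g h
  proof -
    have "exp (- \<gamma> * gp (\<phi> g) (\<phi> h)) \<le> T * d (\<phi> g) (\<phi> h)"
      using visual_lower cl g h ne by blast
    also have "\<dots> \<le> T * (K * d g h powr r)"
      using hold[OF g h] T_ge_1 by (intro mult_left_mono) auto
    also have "\<dots> \<le> T * (K * (T * exp (- \<gamma> * gp g h)) powr r)"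
      using visual_upper[OF g h] T_ge_1 K r by (intro mult_left_mono powr_mono2) auto
    also have "\<dots> = T * K * T powr r * exp (- \<gamma> * r * gp g h)"
      using T_ge_1 by (simp add: powr_mult exp_powr_real mult_ac)
    finally have "ln (exp (- \<gamma> * gp (\<phi> g) (\<phi> h))) \<le> ln (T * K * T powr r * exp (- \<gamma> * r * gp g h))"
      using T_ge_1 K by (subst ln_le_cancel_iff) auto
    also have "\<dots> = ln (T * K * T powr r) + (- \<gamma> * r * gp g h)"
      using T_ge_1 K by (subst ln_mult) auto
    finally have "\<gamma> * r * gp g h \<le> \<gamma> * gp (\<phi> g) (\<phi> h) + ln (T * K * T powr r)"
      by simp
    then show ?thesis
      using r \<gamma>_pos by (simp add: Q_def field_simps)
  qed
  obtain k where k: "k \<in> carrier G" "\<phi> k \<noteq> \<one>"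
    using nontriv by force
  \<comment> \<open>The two added terms are the cost of moving \<open>g\<close> by \<open>k\<close>
    and, scaled by \<open>1 / r\<close>, of moving its image by \<open>\<phi> k\<close>.\<close>
  define Q' where "Q' = \<bar>Q\<bar> + D \<one> k + 1 / r * D \<one> (\<phi> k)"
  have "gp g h \<le> 1 / r * gp (\<phi> g) (\<phi> h) + Q'" if g: "g \<in> carrier G" and h: "h \<in> carrier G" for g h
  proof (cases "\<phi> g = \<phi> h")
    case False
    then show ?thesis
      using dist[OF g h] word_dist_nonneg[of \<one> k] divide_nonneg_pos[OF word_dist_nonneg[of \<one> "\<phi> k"] r]
      by (simp add: Q'_def)
  next
    case True
    have gk: "g \<otimes> k \<in> carrier G" and \<phi>gk: "\<phi> (g \<otimes> k) = \<phi> g \<otimes> \<phi> k"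
      using g k hom_mult[OF \<phi>] by auto
    have ne: "\<phi> (g \<otimes> k) \<noteq> \<phi> h"
      using True k l_cancel_one[OF cl[OF g] cl[OF k(1)]] by (simp add: \<phi>gk)
    have "D g (g \<otimes> k) = D \<one> k"
      using word_dist_translate[of g \<one> k] g k by simp
    then have "gp g h \<le> gp (g \<otimes> k) h + D \<one> k"
      using gromov_product_lipschitz[OF base g h gk] by simp
    also have "gp (g \<otimes> k) h \<le> 1 / r * gp (\<phi> (g \<otimes> k)) (\<phi> h) + \<bar>Q\<bar>"
      using dist[OF gk h ne] by simp
    also have "gp (\<phi> (g \<otimes> k)) (\<phi> h) \<le> gp (\<phi> g) (\<phi> h) + D \<one> (\<phi> k)"
    proof -
      have "D (\<phi> g \<otimes> \<phi> k) (\<phi> g \<otimes> \<one>) = D \<one> (\<phi> k)"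
        using word_dist_translate[of "\<phi> g" "\<phi> k" \<one>] word_dist_sym[of \<one> "\<phi> k"] cl g k by simp
      then show ?thesis
        using gromov_product_lipschitz[OF base cl[OF gk] cl[OF h] cl[OF g]] cl g by (simp add: \<phi>gk)
    qed
    finally show ?thesis
      using r by (simp add: Q'_def field_simps)
  qed
  then show ?thesis
    using r by (intro exI[of _ "1 / r"] exI[of _ Q']) auto
qed

text \<open>The Gromov product of \<open>x\<close> with itself is \<open>D p x\<close>, so the
  diagonal of the bound already gives the lower estimate for distances from \<open>p\<close>. Left
  invariance extends it to all pairs; the upper estimate is \<open>hom_lipschitz\<close>.\<close>

lemma gromov_product_bound_imp_qi:
  assumes \<phi>: "\<phi> \<in> hom G G" and P: "P > 0"
    and bound: "\<And>g h. g \<in> carrier G \<Longrightarrow> h \<in> carrier G \<Longrightarrow> gp g h \<le> P * gp (\<phi> g) (\<phi> h) + Q"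
  shows "qi_embedding (carrier G) D D \<phi>"
proof -
  have cl: "\<phi> g \<in> carrier G" if "g \<in> carrier G" for g
    using hom_in_carrier[OF \<phi> that] .
  obtain M where M: "M \<ge> 1" "\<And>g h. g \<in> carrier G \<Longrightarrow> h \<in> carrier G \<Longrightarrow> D (\<phi> g) (\<phi> h) \<le> M * D g h"
    using hom_lipschitz[OF \<phi>] by metis
  \<comment> \<open>Changing the base point from \<open>p\<close> to \<open>\<one>\<close> costs
    \<open>D \<one> p\<close> on the left and \<open>P * D \<one> p\<close> on the right;
    \<open>\<bar>Q\<bar>\<close> keeps the constant nonnegative.\<close>
  define c where "c = D \<one> p + P * D \<one> p + \<bar>Q\<bar>"
  define L where "L = max M P"
  have L: "L \<ge> 1" "P \<le> L" "M \<le> L"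
    using M(1) by (auto simp: L_def)
  have c: "c \<ge> 0"
    using P word_dist_nonneg by (simp add: c_def)
  have one: "D \<one> x \<le> P * D \<one> (\<phi> x) + c" if x: "x \<in> carrier G" for x
  proof -
    have "D p x \<le> P * D p (\<phi> x) + Q"
      using bound[OF x x] by (simp add: gromov_product_def word_dist_refl)
    also have "D p (\<phi> x) \<le> D \<one> p + D \<one> (\<phi> x)"
      using word_dist_triangle[of p \<one> "\<phi> x"] word_dist_sym[of \<one> p] base cl x by simp
    finally have "D p x \<le> P * (D \<one> p + D \<one> (\<phi> x)) + Q"
      using P by simp
    then show ?thesis
      using word_dist_triangle[of \<one> p x] base x by (simp add: c_def algebra_simps)
  qed
  have lower: "1 / L * D g h - c \<le> D (\<phi> g) (\<phi> h)" if g: "g \<in> carrier G" and h: "h \<in> carrier G" for g h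
  proof -
    interpret \<phi>: group_hom G G \<phi>
      by unfold_locales (rule \<phi>)
    have "D (\<phi> g) (\<phi> h) = D \<one> (\<phi> (inv g \<otimes> h))"
      using word_dist_one[OF cl[OF g] cl[OF h]] g h by simp
    then have "D g h \<le> P * D (\<phi> g) (\<phi> h) + c"
      using one[of "inv g \<otimes> h"] word_dist_one[OF g h] g h by simp
    also have "\<dots> \<le> L * D (\<phi> g) (\<phi> h) + L * c"
      using L c mult_right_mono[OF L(2) word_dist_nonneg[of "\<phi> g" "\<phi> h"]] mult_right_mono[OF L(1) c] by simp
    finally show ?thesis
      using L by (simp add: field_simps)
  qed
  have upper: "D (\<phi> g) (\<phi> h) \<le> L * D g h + c" if "g \<in> carrier G" "h \<in> carrier G" for g h
    using M(2)[OF that] mult_right_mono[OF L(3) word_dist_nonneg[of g h]] c by simp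
  show ?thesis
    unfolding qi_embedding_def using L(1) c lower upper by blast
qed

end

section \<open>Quasiconvexity\<close>

lemma supp_vert: "supp (vert g) = {g}"
  by (auto simp: supp_def vert_def indicator_def)

lemma vert_self: "vert g g = 1"
  by (simp add: vert_def)

context fg_group
begin

lemma cayley_cell_word_dist_le:
  assumes "c \<in> cayley_cells G A" "u \<in> c" "v \<in> c"
  shows "u \<in> carrier G" "D u v \<le> 1"
  using assms edge_closed edge_sym word_dist_edge_le by (auto simp: cayley_cells_def word_dist_refl)

lemma finite_cayley_cell: "c \<in> cayley_cells G A \<Longrightarrow> finite c"
  by (auto simp: cayley_cells_def)

text \<open>A point may lie in several cells but has only one support, so later estimates refer to
  the support.\<close>

lemma cayley_point_supp:
  assumes "w \<in> cayley_points G A"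
  shows "finite (supp w)" "supp w \<noteq> {}" "supp w \<subseteq> carrier G" "sum w (supp w) = 1"
    and "\<And>u. 0 \<le> w u" "\<And>u. w u \<le> 1"
    and "\<And>u v. u \<in> supp w \<Longrightarrow> v \<in> supp w \<Longrightarrow> D u v \<le> 1"
proof -
  obtain c where c: "c \<in> cayley_cells G A" "supp w \<subseteq> c" "sum w c = 1" and nn: "\<And>u. 0 \<le> w u"
    using assms by (auto simp: cayley_points_def)
  show fin: "finite (supp w)"
    using c(1,2) finite_cayley_cell finite_subset by blast
  show sum: "sum w (supp w) = 1"
    using c finite_cayley_cell sum.mono_neutral_left[OF _ c(2), of w] by (auto simp: supp_def)
  then show "supp w \<noteq> {}"
    by auto
  show "supp w \<subseteq> carrier G" "\<And>u v. u \<in> supp w \<Longrightarrow> v \<in> supp w \<Longrightarrow> D u v \<le> 1"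
    using c cayley_cell_word_dist_le by blast+
  show "0 \<le> w u" for u
    by (rule nn)
  show "w u \<le> 1" for u
  proof (cases "u \<in> supp w")
    case True
    then show ?thesis
      using member_le_sum[OF True _ fin, of w] nn sum by simp
  qed (simp add: supp_def)
qed

text \<open>In a common cell both quantities lie between 0 and 1. Otherwise the minimum is bounded
  above by the path through \<open>v\<close>, and below because any other exit \<open>u\<close> is
  at distance at most 1 from \<open>v\<close>.\<close>

lemma cayley_dist_word_dist:
  assumes w: "w \<in> cayley_points G A" and v: "v \<in> supp w" and g: "g \<in> carrier G"
  shows "\<bar>cayley_dist G A w (vert g) - D v g\<bar> \<le> 1"
proof -
  note S = cayley_point_supp[OF w]
  have vc: "v \<in> carrier G"
    using v S(3) by blast
  show ?thesis
  proof (cases "\<exists>c\<in>cayley_cells G A. supp w \<union> supp (vert g) \<subseteq> c")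
    case True
    then have "D v g \<le> 1"
      using cayley_cell_word_dist_le(2) v by (auto simp: supp_vert)
    moreover have "cayley_dist G A w (vert g) = (\<Sum>u\<in>supp w \<union> {g}. \<bar>w u - vert g u\<bar>) / 2"
      using True by (simp add: cayley_dist_def supp_vert)
    moreover have "(\<Sum>u\<in>supp w \<union> {g}. \<bar>w u - vert g u\<bar>) \<le> 2"
    proof -
      have "(\<Sum>u\<in>supp w \<union> {g}. \<bar>w u - vert g u\<bar>) \<le> (\<Sum>u\<in>supp w \<union> {g}. w u + vert g u)"
      proof (rule sum_mono)
        show "\<bar>w u - vert g u\<bar> \<le> w u + vert g u" for u
          using S(5)[of u] by (auto simp: vert_def indicator_def)
      qed
      also have "\<dots> = sum w (supp w \<union> {g}) + sum (vert g) (supp w \<union> {g})"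
        by (rule sum.distrib)
      also have "sum w (supp w \<union> {g}) = sum w (supp w)"
        using S(1) by (intro sum.mono_neutral_right) (auto simp: supp_def)
      also have "sum (vert g) (supp w \<union> {g}) = sum (vert g) {g}"
        using S(1) by (intro sum.mono_neutral_right) (auto simp: vert_def)
      finally show ?thesis
        using S(4) by (simp add: vert_def)
    qed
    moreover have "0 \<le> (\<Sum>u\<in>supp w \<union> {g}. \<bar>w u - vert g u\<bar>)"
      by (intro sum_nonneg) auto
    ultimately show ?thesis
      using word_dist_nonneg[of v g] by linarith
  next
    case False
    define S' where "S' = (\<lambda>u. 1 - w u + D u g) ` supp w"
    have "cayley_dist G A w (vert g) =
        Min {(1 - w u) + D u u' + (1 - vert g u') | u u'. u \<in> supp w \<and> u' \<in> supp (vert g)}"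
      unfolding cayley_dist_def using False by (rule if_not_P)
    also have "{(1 - w u) + D u u' + (1 - vert g u') | u u'. u \<in> supp w \<and> u' \<in> supp (vert g)} = S'"
      by (auto simp: S'_def supp_vert vert_self)
    finally have eq: "cayley_dist G A w (vert g) = Min S'" .
    have fin: "finite S'" "S' \<noteq> {}"
      using S(1,2) by (auto simp: S'_def)
    have "Min S' \<le> 1 - w v + D v g"
      using fin(1) v by (intro Min_le) (auto simp: S'_def)
    moreover have "D v g - 1 \<le> Min S'"
    proof (intro Min.boundedI[OF fin])
      fix a assume "a \<in> S'"
      then obtain u where u: "u \<in> supp w" "a = 1 - w u + D u g"
        by (auto simp: S'_def)
      have "D v g \<le> D v u + D u g"
        using u(1) S(3) vc g by (intro word_dist_triangle) auto
      then show "D v g - 1 \<le> a"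
        using S(7)[OF v u(1)] S(6)[of u] u(2) by linarith
    qed
    ultimately show ?thesis
      using eq S(5)[of v] by linarith
  qed
qed

text \<open>At time \<open>s\<close> on a segment of length \<open>l\<close>, a vertex
  \<open>u\<close> in the support has distance at most \<open>s + 1\<close> and
  \<open>l - s + 1\<close> from the ends. Being near a geodesic thus becomes a condition on Gromov
  products.\<close>

lemma geodesic_segment_near_vertex:
  assumes S: "geodesic_segment (cayley_points G A) (cayley_dist G A) (vert g) (vert h) S"
    and x: "x \<in> S" and g: "g \<in> carrier G" and h: "h \<in> carrier G"
  obtains u where "u \<in> carrier G" "x \<in> cayley_points G A" "u \<in> supp x" "gromov_product G A u g h \<le> 1"
proof -
  obtain c l where c: "0 \<le> l" "c \<in> {0..l} \<rightarrow> cayley_points G A" "c 0 = vert g" "c l = vert h"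
    "\<And>s t. s \<in> {0..l} \<Longrightarrow> t \<in> {0..l} \<Longrightarrow> cayley_dist G A (c s) (c t) = \<bar>s - t\<bar>" "S = c ` {0..l}"
    using S unfolding geodesic_segment_def by blast
  obtain s where s: "s \<in> {0..l}" "x = c s"
    using x c(6) by blast
  have xp: "x \<in> cayley_points G A"
    using c(2) s by blast
  obtain u where u: "u \<in> supp x"
    using cayley_point_supp(2)[OF xp] by blast
  have uc: "u \<in> carrier G"
    using u cayley_point_supp(3)[OF xp] by blast
  have "D g h = l"
    using c(5)[of 0 l] c(1,3,4) cayley_dist_vert[OF is_group gens_closed g] by simp
  moreover have "D u g \<le> s + 1" "D u h \<le> l - s + 1"
    using cayley_dist_word_dist[OF xp u g] cayley_dist_word_dist[OF xp u h] c(5)[OF s(1), of 0]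
      c(5)[OF s(1), of l] c(1,3,4) s by auto
  ultimately have "gromov_product G A u g h \<le> 1"
    by (simp add: gromov_product_def)
  then show thesis
    using that uc xp u by blast
qed

lemma gromov_product_translate:
  assumes "x \<in> carrier G" "u \<in> carrier G" "g \<in> carrier G" "h \<in> carrier G"
  shows "gromov_product G A (x \<otimes> u) (x \<otimes> g) (x \<otimes> h) = gromov_product G A u g h"
  using assms by (simp add: gromov_product_def word_dist_translate)

text \<open>Reduces quasiconvexity to the word metric. Passing from the vertex \<open>u\<close> back
  to a point of the segment costs 1, and \<open>max 0\<close> makes the constant
  nonnegative.\<close>

lemma quasiconvex_subgroupI:
  assumes H: "subgroup H G"
    and near: "\<And>u g h. u \<in> carrier G \<Longrightarrow> g \<in> H \<Longrightarrow> h \<in> H \<Longrightarrow> gromov_product G A u g h \<le> 1 \<Longrightarrow> \<exists>k\<in>H. D u k \<le> R"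
  shows "quasiconvex_subgroup G A H"
proof -
  have HG: "H \<subseteq> carrier G"
    using H by (rule subgroup.subset)
  have "dist_to_set (cayley_dist G A) x (vert ` H) \<le> max 0 (R + 1)"
    if g: "g \<in> H" and h: "h \<in> H" and x: "x \<in> S"
      and S: "geodesic_segment (cayley_points G A) (cayley_dist G A) (vert g) (vert h) S" for g h S x
  proof -
    obtain u where u: "u \<in> carrier G" "x \<in> cayley_points G A" "u \<in> supp x" "gromov_product G A u g h \<le> 1"
      using geodesic_segment_near_vertex[OF S x] HG g h by blast
    obtain k where k: "k \<in> H" "D u k \<le> R"
      using near[OF u(1) g h u(4)] by blast
    \<comment> \<open>A crude lower bound suffices: a real infimum lies below its members once the
      set is bounded below.\<close>
    have "-1 \<le> cayley_dist G A x (vert y)" if "y \<in> H" for y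
      using cayley_dist_word_dist[OF u(2,3), of y] HG that word_dist_nonneg[of u y] by auto
    then have "bdd_below ((\<lambda>y. cayley_dist G A x y) ` vert ` H)"
      by (intro bdd_belowI[of _ "-1"]) auto
    then have "dist_to_set (cayley_dist G A) x (vert ` H) \<le> cayley_dist G A x (vert k)"
      unfolding dist_to_set_def using k(1) by (intro cINF_lower) auto
    also have "\<dots> \<le> R + 1"
      using cayley_dist_word_dist[OF u(2,3), of k] k HG by auto
    finally show ?thesis
      by simp
  qed
  then show ?thesis
    unfolding quasiconvex_subgroup_def using H by (intro conjI exI[of _ "max 0 (R + 1)"]) auto
qed

end

section \<open>Finite kernel and quasiconvex image of a quasi-isometric embedding\<close>

context visual_group
begin

text \<open>The lower estimate between \<open>\<one>\<close> and a kernel element confines the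
  kernel to a ball.\<close>

lemma qi_imp_virtually_injective:
  assumes \<phi>: "\<phi> \<in> hom G G" and qi: "qi_embedding (carrier G) D D \<phi>"
  shows "virtually_injective G \<phi>"
proof -
  obtain L K where L: "L \<ge> 1" and
    lower: "\<And>g h. g \<in> carrier G \<Longrightarrow> h \<in> carrier G \<Longrightarrow> 1 / L * D g h - K \<le> D (\<phi> g) (\<phi> h)"
    using qi unfolding qi_embedding_def by blast
  have "D \<one> g \<le> L * K" if "g \<in> carrier G" "\<phi> g = \<one>" for g
    using lower[of \<one> g] that L hom_one[OF \<phi> is_group is_group] by (simp add: word_dist_refl field_simps)
  then have "kernel G G \<phi> \<subseteq> {g \<in> carrier G. D \<one> g \<le> L * K}"
    by (auto simp: kernel_def)
  then show ?thesis
    unfolding virtually_injective_def using finite_ball by (rule finite_subset)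
qed

text \<open>After \<open>u\<close> is translated to \<open>p\<close>, the ends have Gromov product
  at most 1 and hence visual distance at least \<open>exp (- \<gamma>) / T\<close> if they differ. A
  quasigeodesic staying farther than \<open>\<rho>\<close> from \<open>u\<close> would contradict
  this.\<close>

lemma qi_imp_quasiconvex:
  assumes \<phi>: "\<phi> \<in> hom G G" and qi: "qi_embedding (carrier G) D D \<phi>"
  shows "quasiconvex_subgroup G A (\<phi> ` carrier G)"
proof -
  interpret \<phi>: group_hom G G \<phi>
    by unfold_locales (rule \<phi>)
  obtain L K where L: "L \<ge> 1" and
    lower: "\<And>g h. g \<in> carrier G \<Longrightarrow> h \<in> carrier G \<Longrightarrow> 1 / L * D g h - K \<le> D (\<phi> g) (\<phi> h)"
    using qi unfolding qi_embedding_def by blast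
  obtain M where lip: "\<And>g h. g \<in> carrier G \<Longrightarrow> h \<in> carrier G \<Longrightarrow> D (\<phi> g) (\<phi> h) \<le> M * D g h"
    using hom_lipschitz[OF \<phi>] by metis
  have Lpos: "L > 0"
    using L by simp
  obtain C where C: "C > 0"
    "\<And>x n R. (\<forall>i\<le>n. x i \<in> carrier G) \<and> (\<forall>i<n. D (x i) (x (Suc i)) \<le> M) \<and>
      (\<forall>i\<le>n. \<forall>j\<le>n. \<bar>real i - real j\<bar> / L - K \<le> D (x i) (x j)) \<and>
      (\<forall>i\<le>n. R \<le> D p (x i)) \<Longrightarrow> d (x 0) (x n) \<le> C * exp (- \<gamma> * R / 3)"
    using quasigeodesic_visual_dist[OF Lpos, of M K] by blast
  \<comment> \<open>Chosen so that \<open>T * (C * exp (- \<gamma> * \<rho> / 3))\<close> equals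
    \<open>exp (- \<gamma> - 1)\<close>.\<close>
  define \<rho> where "\<rho> = 3 * (1 + (ln (T * C) + 1) / \<gamma>)"
  have \<rho>: "T * (C * exp (- \<gamma> * \<rho> / 3)) < exp (- \<gamma>)"
  proof -
    have "- \<gamma> * \<rho> / 3 = (- \<gamma> - 1) - ln (T * C)"
      using \<gamma>_pos by (simp add: \<rho>_def field_simps)
    then have "T * (C * exp (- \<gamma> * \<rho> / 3)) = exp (- \<gamma> - 1)"
      using C(1) T_ge_1 by (simp add: exp_diff)
    then show ?thesis
      by simp
  qed
  have near: "\<exists>k\<in>carrier G. D u (\<phi> k) \<le> max 1 \<rho>"
    if u: "u \<in> carrier G" and g: "g \<in> carrier G" and h: "h \<in> carrier G"
      and le: "gromov_product G A u (\<phi> g) (\<phi> h) \<le> 1" for u g h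
  proof (cases "\<phi> g = \<phi> h")
    case True
    \<comment> \<open>For equal ends the Gromov product is the distance itself; hence the 1 in
      \<open>max 1 \<rho>\<close>.\<close>
    then have "D u (\<phi> g) \<le> 1"
      using le by (simp add: gromov_product_def word_dist_refl)
    then show ?thesis
      using g by force
  next
    case False
    obtain v n where v: "geodesic_word v n" "v 0 = g" "v n = h"
      using geodesic_word_exists[OF g h] .
    have vcl: "\<And>i. i \<le> n \<Longrightarrow> v i \<in> carrier G"
      and vd: "\<And>i j. i \<le> n \<Longrightarrow> j \<le> n \<Longrightarrow> D (v i) (v j) = \<bar>real i - real j\<bar>"
      using v(1) by (auto simp: geodesic_word_def)
    \<comment> \<open>The word metric is left invariant but \<open>d\<close> need not be, so
      \<open>d\<close> is applied only after the translation taking \<open>u\<close> to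
      \<open>p\<close>.\<close>
    define t where "t = p \<otimes> inv u"
    have t: "t \<in> carrier G" "t \<otimes> u = p"
      using base u by (auto simp: t_def m_assoc)
    have Dt: "D (t \<otimes> \<phi> (v i)) (t \<otimes> \<phi> (v j)) = D (\<phi> (v i)) (\<phi> (v j))" if "i \<le> n" "j \<le> n" for i j
      using that t vcl by (intro word_dist_translate) auto
    show ?thesis
    proof (rule ccontr)
      assume "\<not> ?thesis"
      then have far: "\<rho> < D u (\<phi> (v i))" if "i \<le> n" for i
        using vcl[OF that] by force
      have "d (t \<otimes> \<phi> (v 0)) (t \<otimes> \<phi> (v n)) \<le> C * exp (- \<gamma> * \<rho> / 3)"
      proof (intro C(2)[of n "\<lambda>i. t \<otimes> \<phi> (v i)"] conjI allI impI)
        show "t \<otimes> \<phi> (v i) \<in> carrier G" if "i \<le> n" for i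
          using that vcl t by simp
        show "D (t \<otimes> \<phi> (v i)) (t \<otimes> \<phi> (v (Suc i))) \<le> M" if "i < n" for i
          using lip[OF vcl[of i] vcl[of "Suc i"]] vd[of i "Suc i"] Dt[of i "Suc i"] that by simp
        show "\<bar>real i - real j\<bar> / L - K \<le> D (t \<otimes> \<phi> (v i)) (t \<otimes> \<phi> (v j))" if "i \<le> n" "j \<le> n" for i j
          using lower[OF vcl[of i] vcl[of j]] vd[of i j] Dt[of i j] that by simp
        show "\<rho> \<le> D p (t \<otimes> \<phi> (v i))" if "i \<le> n" for i
          using far[OF that] word_dist_translate[OF t(1) u, of "\<phi> (v i)"] vcl[OF that] t(2) by simp
      qed
      then have "T * d (t \<otimes> \<phi> g) (t \<otimes> \<phi> h) \<le> T * (C * exp (- \<gamma> * \<rho> / 3))"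
        using T_ge_1 v(2,3) by simp
      also note \<rho>
      also have "exp (- \<gamma>) \<le> exp (- \<gamma> * gp (t \<otimes> \<phi> g) (t \<otimes> \<phi> h))"
        using gromov_product_translate[OF t(1) u, of "\<phi> g" "\<phi> h"] t(2) g h le \<gamma>_pos by simp
      also have "\<dots> \<le> T * d (t \<otimes> \<phi> g) (t \<otimes> \<phi> h)"
        using t(1) g h False by (intro visual_lower) auto
      finally show False
        by simp
    qed
  qed
  show ?thesis
  proof (rule quasiconvex_subgroupI)
    show "subgroup (\<phi> ` carrier G) G"
      by (rule \<phi>.img_is_subgroup)
    show "\<exists>k\<in>\<phi> ` carrier G. D u k \<le> max 1 \<rho>"
      if "u \<in> carrier G" "g \<in> \<phi> ` carrier G" "h \<in> \<phi> ` carrier G" "gromov_product G A u g h \<le> 1" for u g h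
      using that near by blast
  qed
qed

end

section \<open>Geodesics in the realization of the Cayley graph\<close>

context fg_group
begin

lemma cayley_dist_commute:
  assumes w: "w \<in> cayley_points G A" and w': "w' \<in> cayley_points G A"
  shows "cayley_dist G A w w' = cayley_dist G A w' w"
proof -
  have "(1 - w u) + D u v + (1 - w' v) = (1 - w' v) + D v u + (1 - w u)"
    if "u \<in> supp w" "v \<in> supp w'" for u v
    using that cayley_point_supp(3)[OF w] cayley_point_supp(3)[OF w'] word_dist_sym[of u v] by auto
  then have eq: "{(1 - w u) + D u v + (1 - w' v) | u v. u \<in> supp w \<and> v \<in> supp w'}
      = {(1 - w' v) + D v u + (1 - w u) | v u. v \<in> supp w' \<and> u \<in> supp w}"
    by force
  show ?thesis
    unfolding cayley_dist_def Un_commute[of "supp w'" "supp w"] eq by (auto simp: abs_minus_commute)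
qed

text \<open>
  The point at time \<open>t\<close> on the edge path \<open>v\<close>; as \<open>v\<close> is a geodesic, \<open>D (v 0) u\<close> recovers the
  position of the vertex \<open>u\<close> on it.
\<close>

definition realize :: "(nat \<Rightarrow> 'a) \<Rightarrow> nat \<Rightarrow> real \<Rightarrow> 'a \<Rightarrow> real" where
  "realize v n t u = (if u \<in> v ` {..n} then max 0 (1 - \<bar>t - D (v 0) u\<bar>) else 0)"

lemma realize_vertex:
  assumes "geodesic_word v n" "k \<le> n"
  shows "realize v n t (v k) = max 0 (1 - \<bar>t - real k\<bar>)"
  using assms by (auto simp: realize_def geodesic_word_def)

lemma geodesic_word_inj: "geodesic_word v n \<Longrightarrow> i \<le> n \<Longrightarrow> j \<le> n \<Longrightarrow> v i = v j \<Longrightarrow> i = j"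
  unfolding geodesic_word_def by (metis abs_eq_0 eq_iff_diff_eq_0 of_nat_eq_iff word_dist_refl)

lemma supp_realize:
  assumes "geodesic_word v n"
  shows "supp (realize v n t) = {v k | k. k \<le> n \<and> \<bar>t - real k\<bar> < 1}"
proof -
  have "u \<in> v ` {..n}" if "realize v n t u \<noteq> 0" for u
    using that by (auto simp: realize_def split: if_splits)
  then show ?thesis
    using realize_vertex[OF assms, of _ t] by (fastforce simp: supp_def)
qed

lemma supp_realize_edge:
  assumes "geodesic_word v n" "real i \<le> t" "t \<le> real (Suc i)"
  shows "supp (realize v n t) \<subseteq> {v i, v (Suc i)}"
proof -
  have "k = i \<or> k = Suc i" if "\<bar>t - real k\<bar> < 1" for k
    using that assms(2,3) by linarith
  then show ?thesis
    unfolding supp_realize[OF assms(1)] by auto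
qed

lemma geodesic_word_cell:
  assumes "geodesic_word v n" "i < n"
  shows "{v i, v (Suc i)} \<in> cayley_cells G A"
  using geodesic_word_edge[OF assms] by (auto simp: cayley_cells_def)

lemma realize_int:
  assumes v: "geodesic_word v n" and k: "k \<le> n"
  shows "realize v n (real k) = vert (v k)"
proof
  fix u
  show "realize v n (real k) u = vert (v k) u"
  proof (cases "u \<in> v ` {..n}")
    case True
    then obtain j where j: "j \<le> n" "u = v j"
      by blast
    show ?thesis
      using realize_vertex[OF v j(1), of "real k"] geodesic_word_inj[OF v j(1) k] j(2)
      by (cases "j = k") (auto simp: vert_def indicator_def)
  next
    case False
    then show ?thesis
      using k by (auto simp: realize_def vert_def indicator_def)
  qed
qed

lemma realize_cayley_point:
  assumes v: "geodesic_word v n" and t: "0 \<le> t" "t \<le> real n"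
  shows "realize v n t \<in> cayley_points G A"
proof -
  have "\<exists>c\<in>cayley_cells G A. supp (realize v n t) \<subseteq> c \<and> sum (realize v n t) c = 1"
  proof (cases "t = real n")
    case True
    \<comment> \<open>No edge of the path starts at \<open>v n\<close>, so the end, and with it the
      case \<open>n = 0\<close>, uses a vertex cell.\<close>
    have "{v n} \<in> cayley_cells G A"
      using v by (auto simp: cayley_cells_def geodesic_word_def)
    then show ?thesis
      unfolding True realize_int[OF v order_refl] by (intro bexI[of _ "{v n}"]) (auto simp: supp_vert vert_self)
  next
    case False
    define i where "i = nat \<lfloor>t\<rfloor>"
    have i: "real i \<le> t" "t \<le> real (Suc i)" "i < n"
      using t False unfolding i_def by linarith+
    have "v i \<noteq> v (Suc i)"
      using geodesic_word_inj[OF v, of i "Suc i"] i(3) by auto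
    then have "sum (realize v n t) {v i, v (Suc i)} = 1"
      using realize_vertex[OF v, of i t] realize_vertex[OF v, of "Suc i" t] i by simp
    then show ?thesis
      using supp_realize_edge[OF v i(1,2)] geodesic_word_cell[OF v i(3)] by blast
  qed
  moreover have "0 \<le> realize v n t u" for u
    by (simp add: realize_def)
  ultimately show ?thesis
    by (simp add: cayley_points_def)
qed

text \<open>Both points lie in one cell and each of their two coordinates differs by
  \<open>\<bar>s - t\<bar>\<close>; the definition halves the sum.\<close>

lemma cayley_dist_realize_edge:
  assumes v: "geodesic_word v n" and i: "i < n"
    and s: "real i \<le> s" "s \<le> real (Suc i)" and t: "real i \<le> t" "t \<le> real (Suc i)"
  shows "cayley_dist G A (realize v n s) (realize v n t) = \<bar>s - t\<bar>"
proof -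
  let ?c = "{v i, v (Suc i)}"
  let ?f = "\<lambda>u. \<bar>realize v n s u - realize v n t u\<bar>"
  have ne: "v i \<noteq> v (Suc i)"
    using geodesic_word_inj[OF v, of i "Suc i"] i by auto
  have sub: "supp (realize v n s) \<union> supp (realize v n t) \<subseteq> ?c"
    using supp_realize_edge[OF v s] supp_realize_edge[OF v t] by blast
  then have "cayley_dist G A (realize v n s) (realize v n t)
      = sum ?f (supp (realize v n s) \<union> supp (realize v n t)) / 2"
    unfolding cayley_dist_def using geodesic_word_cell[OF v i] by (intro if_P) blast
  also have "sum ?f (supp (realize v n s) \<union> supp (realize v n t)) = sum ?f ?c"
    using sub by (intro sum.mono_neutral_left) (auto simp: supp_def)
  also have "\<dots> = ?f (v i) + ?f (v (Suc i))"
    by (simp add: ne)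
  also have "\<dots> = 2 * \<bar>s - t\<bar>"
  proof -
    have "max 0 (1 - \<bar>s - real i\<bar>) = 1 - (s - real i)" "max 0 (1 - \<bar>t - real i\<bar>) = 1 - (t - real i)"
      "max 0 (1 - \<bar>s - real (Suc i)\<bar>) = s - real i" "max 0 (1 - \<bar>t - real (Suc i)\<bar>) = t - real i"
      using s t by auto
    then show ?thesis
      using realize_vertex[OF v, of i] realize_vertex[OF v, of "Suc i"] i by simp
  qed
  finally show ?thesis
    by simp
qed

text \<open>If no edge of the path contains both points, every candidate in the minimum is a route
  from \<open>s\<close> to \<open>t\<close> on the real line through integers, so it has length at
  least \<open>t - s\<close>; suitable roundings attain this.\<close>

lemma cayley_dist_realize_le:
  assumes v: "geodesic_word v n" and st: "0 \<le> s" "s \<le> t" "t \<le> real n"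
  shows "cayley_dist G A (realize v n s) (realize v n t) = t - s"
proof -
  define i where "i = nat \<lfloor>s\<rfloor>"
  have i: "real i \<le> s" "s < real (Suc i)" "i \<le> n"
    using st unfolding i_def by linarith+
  consider "s = real n" | "i < n" "t \<le> real (Suc i)" | "real (Suc i) < t"
    using i st by linarith
  then show ?thesis
  proof cases
    case 1
    then show ?thesis
      using st realize_int[OF v order_refl] cayley_dist_vert[OF is_group gens_closed, of "v n" "v n"] v
      by (simp add: word_dist_refl geodesic_word_def)
  next
    case 2
    then show ?thesis
      using cayley_dist_realize_edge[OF v 2(1), of s t] i st by simp
  next
    case 3
    \<comment> \<open>The minimum is attained by leaving through \<open>v a\<close> and entering
      through \<open>v b\<close>. The vertices \<open>v i\<close> and \<open>v e\<close> lie in the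
      two supports at distance at least 2, which excludes a common cell.\<close>
    define a where "a = nat \<lceil>s\<rceil>"
    define b where "b = nat \<lfloor>t\<rfloor>"
    define e where "e = nat \<lceil>t\<rceil>"
    have a: "s \<le> real a" "real a < s + 1" and b: "real b \<le> t" "t < real b + 1"
      and e: "t \<le> real e" "real e < t + 1"
      using st unfolding a_def b_def e_def by linarith+
    have "real a < real (Suc (Suc i))" "real (Suc i) < real (Suc b)" "real b \<le> real n"
      "real e < real (Suc n)" "real (Suc i) < real e"
      using a b e st i 3 by simp_all
    then have ab: "a \<le> b" "b \<le> n" and e': "e \<le> n" "Suc i < e"
      unfolding of_nat_less_iff of_nat_le_iff by simp_all
    have vcl: "\<And>k. k \<le> n \<Longrightarrow> v k \<in> carrier G"
      and vd: "\<And>k m. k \<le> n \<Longrightarrow> m \<le> n \<Longrightarrow> D (v k) (v m) = \<bar>real k - real m\<bar>"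
      using v by (auto simp: geodesic_word_def)
    have "\<not> (\<exists>c\<in>cayley_cells G A. supp (realize v n s) \<union> supp (realize v n t) \<subseteq> c)"
    proof
      assume "\<exists>c\<in>cayley_cells G A. supp (realize v n s) \<union> supp (realize v n t) \<subseteq> c"
      moreover have "v i \<in> supp (realize v n s)" "v e \<in> supp (realize v n t)"
        using i e e' unfolding supp_realize[OF v] by auto
      ultimately have "D (v i) (v e) \<le> 1"
        using cayley_cell_word_dist_le(2) by blast
      then show False
        using vd[of i e] i(3) e' by simp
    qed
    then have "cayley_dist G A (realize v n s) (realize v n t) =
      Min {(1 - realize v n s u) + D u w + (1 - realize v n t w) | u w.
        u \<in> supp (realize v n s) \<and> w \<in> supp (realize v n t)}" (is "_ = Min ?X")
      unfolding cayley_dist_def by (rule if_not_P)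
    also have X: "?X = (\<lambda>(k, m). \<bar>s - real k\<bar> + \<bar>real k - real m\<bar> + \<bar>t - real m\<bar>) `
        ({k. k \<le> n \<and> \<bar>s - real k\<bar> < 1} \<times> {m. m \<le> n \<and> \<bar>t - real m\<bar> < 1})" (is "_ = ?f ` ?I")
    proof -
      have "(1 - realize v n s (v k)) + D (v k) (v m) + (1 - realize v n t (v m)) = ?f (k, m)"
        if "k \<le> n" "\<bar>s - real k\<bar> < 1" "m \<le> n" "\<bar>t - real m\<bar> < 1" for k m
        using that realize_vertex[OF v that(1), of s] realize_vertex[OF v that(3), of t] vd[OF that(1,3)]
        by simp
      note eq = this
      show ?thesis
      proof (rule equalityI; rule subsetI)
        fix y assume "y \<in> ?X"
        then obtain u w where "u \<in> supp (realize v n s)" "w \<in> supp (realize v n t)"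
          and y: "y = (1 - realize v n s u) + D u w + (1 - realize v n t w)"
          by blast
        then obtain k m where "k \<le> n" "\<bar>s - real k\<bar> < 1" "m \<le> n" "\<bar>t - real m\<bar> < 1" "u = v k" "w = v m"
          unfolding supp_realize[OF v] by blast
        with y show "y \<in> ?f ` ?I"
          using eq[of k m] by (intro image_eqI[of _ _ "(k, m)"]) simp_all
      next
        fix y assume "y \<in> ?f ` ?I"
        then obtain k m where km: "k \<le> n" "\<bar>s - real k\<bar> < 1" "m \<le> n" "\<bar>t - real m\<bar> < 1" "y = ?f (k, m)"
          by blast
        then have "v k \<in> supp (realize v n s)" "v m \<in> supp (realize v n t)"
          unfolding supp_realize[OF v] by blast+
        moreover have "y = (1 - realize v n s (v k)) + D (v k) (v m) + (1 - realize v n t (v m))"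
          using eq[OF km(1-4)] km(5) by simp
        ultimately show "y \<in> ?X"
          by blast
      qed
    qed
    also have "Min (?f ` ?I) = t - s"
    proof (rule Min_eqI)
      show "finite (?f ` ?I)"
        by auto
      show "t - s \<le> y" if y: "y \<in> ?f ` ?I" for y
      proof -
        obtain km where "y = ?f km"
          using y by blast
        then have "y = \<bar>s - real (fst km)\<bar> + \<bar>real (fst km) - real (snd km)\<bar> + \<bar>t - real (snd km)\<bar>"
          by (simp add: case_prod_unfold)
        then show ?thesis
          by linarith
      qed
      have "(a, b) \<in> ?I" "?f (a, b) = t - s"
        using a b ab by auto
      then show "t - s \<in> ?f ` ?I"
        by (intro image_eqI[of _ _ "(a, b)"]) simp_all
    qed
    finally show ?thesis .
  qed
qed

text \<open>Supplies the segments over which quasiconvexity quantifies, one for every vertex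
  geodesic.\<close>

lemma geodesic_word_segment:
  assumes v: "geodesic_word v n"
  shows "geodesic_segment (cayley_points G A) (cayley_dist G A) (vert (v 0)) (vert (v n))
    (realize v n ` {0..real n})"
  unfolding geodesic_segment_def
proof (intro exI[of _ "realize v n"] exI[of _ "real n"] conjI ballI)
  show "realize v n \<in> {0..real n} \<rightarrow> cayley_points G A"
    using realize_cayley_point[OF v] by auto
  show "realize v n 0 = vert (v 0)" "realize v n (real n) = vert (v n)"
    using realize_int[OF v, of 0] realize_int[OF v order_refl] by auto
  show "cayley_dist G A (realize v n s) (realize v n t) = \<bar>s - t\<bar>"
    if s: "s \<in> {0..real n}" and t: "t \<in> {0..real n}" for s t
  proof (cases "s \<le> t")
    case True
    then show ?thesis
      using cayley_dist_realize_le[OF v, of s t] s t by simp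
  next
    case False
    then show ?thesis
      using cayley_dist_realize_le[OF v, of t s] s t
        cayley_dist_commute[OF realize_cayley_point[OF v] realize_cayley_point[OF v], of s t] by simp
  qed
qed auto

section \<open>From quasiconvex images to quasi-isometric embeddings\<close>

lemma quasiconvex_subgroup_geodesic_word:
  assumes "quasiconvex_subgroup G A H"
  obtains q where "\<And>v n i. \<lbrakk>geodesic_word v n; v 0 \<in> H; v n \<in> H; i \<le> n\<rbrakk> \<Longrightarrow> \<exists>k\<in>H. D (v i) k \<le> q"
proof -
  obtain q where q: "\<And>g h S x. \<lbrakk>g \<in> H; h \<in> H;
      geodesic_segment (cayley_points G A) (cayley_dist G A) (vert g) (vert h) S; x \<in> S\<rbrakk>
      \<Longrightarrow> dist_to_set (cayley_dist G A) x (vert ` H) \<le> q" and H: "subgroup H G"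
    using assms unfolding quasiconvex_subgroup_def by blast
  \<comment> \<open>The extra 1 makes the bound on the infimum strict, so that some element of
    \<open>H\<close> satisfies it.\<close>
  have "\<exists>k\<in>H. D (v i) k \<le> q + 1" if v: "geodesic_word v n" and "v 0 \<in> H" "v n \<in> H" and i: "i \<le> n" for v n i
  proof -
    have vi: "v i \<in> carrier G"
      using v i by (simp add: geodesic_word_def)
    have "vert (v i) \<in> realize v n ` {0..real n}"
      using realize_int[OF v i] i by (intro image_eqI[of _ _ "real i"]) auto
    then have "(INF y\<in>vert ` H. cayley_dist G A (vert (v i)) y) < q + 1"
      using q[OF that(2,3) geodesic_word_segment[OF v]] unfolding dist_to_set_def by fastforce
    moreover have "vert ` H \<noteq> {}"
      using subgroup.one_closed[OF H] by blast
    ultimately obtain k where "k \<in> H" "cayley_dist G A (vert (v i)) (vert k) < q + 1"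
      using cInf_lessD[of "cayley_dist G A (vert (v i)) ` vert ` H" "q + 1"] by auto
    then show ?thesis
      using cayley_dist_vert[OF is_group gens_closed vi, of k] by force
  qed
  then show thesis
    using that by blast
qed

text \<open>A geodesic of length \<open>n\<close> from \<open>\<phi> g\<close> to
  \<open>\<phi> h\<close> is lifted to a chain of \<open>n\<close> steps from \<open>g\<close> to
  \<open>h\<close>. Each step maps into the finite set \<open>F\<close>, so it differs from a chosen
  preimage of length at most \<open>B\<close> by a kernel element of length at most
  \<open>C\<close>.\<close>

lemma quasiconvex_imp_qi:
  assumes \<phi>: "\<phi> \<in> hom G G" and vi: "virtually_injective G \<phi>"
    and qc: "quasiconvex_subgroup G A (\<phi> ` carrier G)"
  shows "qi_embedding (carrier G) D D \<phi>"
proof -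
  interpret \<phi>: group_hom G G \<phi>
    by unfold_locales (rule \<phi>)
  obtain q where q: "\<And>v n i. \<lbrakk>geodesic_word v n; v 0 \<in> \<phi> ` carrier G; v n \<in> \<phi> ` carrier G; i \<le> n\<rbrakk>
      \<Longrightarrow> \<exists>k\<in>\<phi> ` carrier G. D (v i) k \<le> q"
    using quasiconvex_subgroup_geodesic_word[OF qc] by metis
  obtain M where M: "M \<ge> 1" "\<And>g h. g \<in> carrier G \<Longrightarrow> h \<in> carrier G \<Longrightarrow> D (\<phi> g) (\<phi> h) \<le> M * D g h"
    using hom_lipschitz[OF \<phi>] by metis
  \<comment> \<open>The radius allows \<open>q\<close> for each of two neighbouring approximations
    and 1 for the edge between them.\<close>
  define F where "F = {y \<in> carrier G. D \<one> y \<le> 2 * q + 1} \<inter> \<phi> ` carrier G"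
  define \<psi> where "\<psi> = inv_into (carrier G) \<phi>"
  have \<psi>: "\<psi> y \<in> carrier G" "\<phi> (\<psi> y) = y" if "y \<in> \<phi> ` carrier G" for y
    using that by (auto simp: \<psi>_def inv_into_into f_inv_into_f)
  have "finite (\<psi> ` F)"
    using finite_ball by (simp add: F_def)
  then obtain B where B: "B \<ge> 0" "\<And>y. y \<in> F \<Longrightarrow> D \<one> (\<psi> y) \<le> B"
    using finite_word_dist_bound by (metis imageI)
  obtain C where C: "C \<ge> 0" "\<And>y. y \<in> kernel G G \<phi> \<Longrightarrow> D \<one> y \<le> C"
    using finite_word_dist_bound vi unfolding virtually_injective_def by metis
  have fiber: "D x y \<le> C" if "x \<in> carrier G" "y \<in> carrier G" "\<phi> x = \<phi> y" for x y
    using C(2)[of "inv x \<otimes> y"] word_dist_one[OF that(1,2)] that by (simp add: kernel_def)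
  have main: "D g h \<le> B' * D (\<phi> g) (\<phi> h) + C + C"
    if g: "g \<in> carrier G" and h: "h \<in> carrier G" and B': "B' = B + C" for g h B'
  proof -
    obtain v n where v: "geodesic_word v n" "v 0 = \<phi> g" "v n = \<phi> h" "D (\<phi> g) (\<phi> h) = real n"
      using geodesic_word_exists[of "\<phi> g" "\<phi> h"] g h by auto
    have vcl: "\<And>i. i \<le> n \<Longrightarrow> v i \<in> carrier G"
      using v(1) by (auto simp: geodesic_word_def)
    have "\<forall>i. \<exists>k. i \<le> n \<longrightarrow> k \<in> carrier G \<and> D (v i) (\<phi> k) \<le> q"
      using q[OF v(1)] v(2,3) g h by blast
    then obtain k where k: "\<And>i. i \<le> n \<Longrightarrow> k i \<in> carrier G" "\<And>i. i \<le> n \<Longrightarrow> D (v i) (\<phi> (k i)) \<le> q"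
      by metis
    have q0: "q \<ge> 0"
      using k(2)[of 0] word_dist_nonneg[of "v 0" "\<phi> (k 0)"] by simp
    \<comment> \<open>The chain must start at \<open>g\<close> and end at \<open>h\<close> exactly.
      For \<open>n = 0\<close> it would only contain \<open>g\<close>; then
      \<open>\<phi> g = \<phi> h\<close> and the bound on fibers applies.\<close>
    define x where "x i = (if i = 0 then g else if i = n then h else k i)" for i
    have x: "x i \<in> carrier G" "D (v i) (\<phi> (x i)) \<le> q" if "i \<le> n" for i
      using that k[OF that] g h q0 v(2,3) by (auto simp: x_def word_dist_refl)
    have step: "D (x i) (x (Suc i)) \<le> B + C" if i: "i < n" for i
    proof -
      have xi: "x i \<in> carrier G" "x (Suc i) \<in> carrier G" "D (v i) (\<phi> (x i)) \<le> q"
        "D (v (Suc i)) (\<phi> (x (Suc i))) \<le> q" "v i \<in> carrier G" "v (Suc i) \<in> carrier G"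
        using x vcl i by auto
      define z where "z = inv (x i) \<otimes> x (Suc i)"
      have "z \<in> carrier G"
        using xi by (simp add: z_def)
      then have z: "z \<in> carrier G" "\<phi> z \<in> \<phi> ` carrier G"
        by blast+
      have "D \<one> (\<phi> z) = D (\<phi> (x i)) (\<phi> (x (Suc i)))"
        using word_dist_one[of "\<phi> (x i)" "\<phi> (x (Suc i))"] xi by (simp add: z_def)
      also have "\<dots> \<le> D (\<phi> (x i)) (v i) + D (v i) (\<phi> (x (Suc i)))"
        using xi by (intro word_dist_triangle) auto
      also have "D (v i) (\<phi> (x (Suc i))) \<le> D (v i) (v (Suc i)) + D (v (Suc i)) (\<phi> (x (Suc i)))"
        using xi by (intro word_dist_triangle) auto
      also have "D (v i) (v (Suc i)) = 1"
        using v(1) i by (simp add: geodesic_word_def)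
      also have "D (\<phi> (x i)) (v i) = D (v i) (\<phi> (x i))"
        using xi by (intro word_dist_sym) auto
      finally have "D \<one> (\<phi> z) \<le> 2 * q + 1"
        using xi by simp
      then have zF: "\<phi> z \<in> F"
        using z by (simp add: F_def)
      have "D (x i) (x (Suc i)) = D \<one> z"
        using xi unfolding z_def by (intro word_dist_one) auto
      also have "\<dots> \<le> D \<one> (\<psi> (\<phi> z)) + D (\<psi> (\<phi> z)) z"
        using z \<psi>(1)[OF z(2)] by (intro word_dist_triangle) auto
      also have "D (\<psi> (\<phi> z)) z \<le> C"
        using z(1) \<psi>[OF z(2)] by (intro fiber) auto
      finally show ?thesis
        using B(2)[OF zF] by simp
    qed
    show ?thesis
    proof (cases "n = 0")
      case True
      then show ?thesis
        using fiber[OF g h] v C(1) by simp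
    next
      case False
      then have "D g h = D (x 0) (x n)"
        by (simp add: x_def)
      also have "\<dots> \<le> real n * (B + C)"
        using x(1) step by (intro word_dist_edge_path_le) auto
      finally show ?thesis
        using v(4) B' C(1) by (simp add: mult.commute)
    qed
  qed
  define L where "L = max M (B + C)"
  have L: "L \<ge> 1" "M \<le> L" "B + C \<le> L"
    using M(1) by (auto simp: L_def)
  have lower: "1 / L * D g h - 2 * C \<le> D (\<phi> g) (\<phi> h)" if g: "g \<in> carrier G" and h: "h \<in> carrier G" for g h
  proof -
    have "D g h \<le> L * D (\<phi> g) (\<phi> h) + L * (2 * C)"
      using main[OF g h refl] mult_right_mono[OF L(3) word_dist_nonneg[of "\<phi> g" "\<phi> h"]]
        mult_right_mono[OF L(1) C(1)] by simp
    then show ?thesis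
      using L(1) by (simp add: field_simps)
  qed
  have upper: "D (\<phi> g) (\<phi> h) \<le> L * D g h + 2 * C" if "g \<in> carrier G" "h \<in> carrier G" for g h
    using M(2)[OF that] mult_right_mono[OF L(2) word_dist_nonneg[of g h]] C(1) by simp
  show ?thesis
    unfolding qi_embedding_def using L(1) C(1) lower upper
    by (intro exI[of _ L] exI[of _ "2 * C"] conjI ballI) auto
qed

end

section \<open>Equivalence of the five conditions\<close>

theorem theorem4p3:
  fixes G :: "('a, 'm) monoid_scheme"
    and A :: "'a set"
    and \<phi> :: "'a \<Rightarrow> 'a"
    and p :: 'a
    and \<gamma> T :: real
    and d :: "'a \<Rightarrow> 'a \<Rightarrow> real"
    and Ghat :: "'b metric"
    and \<iota> :: "'a \<Rightarrow> 'b"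
  assumes "hyperbolic_group G A"
    and "\<phi> \<in> hom G G"
    and "\<phi> ` carrier G \<noteq> {\<one>\<^bsub>G\<^esub>}"
    and "p \<in> carrier G" and "\<gamma> > 0" and "T \<ge> 1"
    and "d \<in> visual_metrics G A p \<gamma> T"
    and "is_metric_completion (carrier G) d Ghat \<iota>"
  shows "let
      cond_i = holder_condition (carrier G) d d \<phi>;
      cond_ii = (\<exists>\<Phi>. \<Phi> \<in> mspace Ghat \<rightarrow> mspace Ghat \<and>
        (\<forall>g\<in>carrier G. \<Phi> (\<iota> g) = \<iota> (\<phi> g)) \<and>
        holder_condition (mspace Ghat) (mdist Ghat) (mdist Ghat) \<Phi>);
      cond_iii = (\<exists>P Q :: real. P > 0 \<and>
        (\<forall>g\<in>carrier G. \<forall>h\<in>carrier G.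
          P * gromov_product G A p (\<phi> g) (\<phi> h) + Q \<ge> gromov_product G A p g h));
      cond_iv = qi_embedding (carrier G) (word_dist G A) (word_dist G A) \<phi>;
      cond_v = (virtually_injective G \<phi> \<and> quasiconvex_subgroup G A (\<phi> ` carrier G))
    in (cond_i \<longleftrightarrow> cond_ii) \<and> (cond_ii \<longleftrightarrow> cond_iii) \<and> (cond_iii \<longleftrightarrow> cond_iv) \<and> (cond_iv \<longleftrightarrow> cond_v)"
proof -
  interpret group G
    using assms(1) by (simp add: hyperbolic_group_def)
  interpret visual_group G A p \<gamma> T d
    using assms by unfold_locales (simp_all add: hyperbolic_group_def)
  \<comment> \<open>The implications form the cycle (i), (iii), (iv), (i), to which (ii) is attached
    at (i) and (v) at (iv).\<close>
  have "holder_condition (carrier G) d d \<phi> \<longleftrightarrow>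
      (\<exists>\<Phi>. \<Phi> \<in> mspace Ghat \<rightarrow> mspace Ghat \<and> (\<forall>g\<in>carrier G. \<Phi> (\<iota> g) = \<iota> (\<phi> g)) \<and>
        holder_condition (mspace Ghat) (mdist Ghat) (mdist Ghat) \<Phi>)"
    using hom_in_carrier[OF assms(2)] by (intro holder_condition_iff_extension metric assms(8)) auto
  moreover have "\<exists>P Q. P > 0 \<and> (\<forall>g\<in>carrier G. \<forall>h\<in>carrier G. gp g h \<le> P * gp (\<phi> g) (\<phi> h) + Q)"
    if "holder_condition (carrier G) d d \<phi>"
    using holder_imp_gromov_product_bound[OF assms(2,3) that] .
  moreover have "qi_embedding (carrier G) D D \<phi>"
    if "\<exists>P Q. P > 0 \<and> (\<forall>g\<in>carrier G. \<forall>h\<in>carrier G. gp g h \<le> P * gp (\<phi> g) (\<phi> h) + Q)"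
    using that gromov_product_bound_imp_qi[OF assms(2)] by blast
  moreover have "qi_embedding (carrier G) D D \<phi> \<longleftrightarrow>
      virtually_injective G \<phi> \<and> quasiconvex_subgroup G A (\<phi> ` carrier G)"
    using qi_imp_virtually_injective qi_imp_quasiconvex quasiconvex_imp_qi assms(2) by blast
  moreover note qi_imp_holder[OF assms(2)]
  ultimately show ?thesis
    unfolding Let_def by argo
qed

end
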